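(* Let $s\in(0,1)$, $N>2s$, and let $\Omega\subset\mathbb{R}^N$ be a bounded open domain with Lipschitz boundary. Let $\{(\lambda_k^{\delta,s},\varphi_k^{\delta,s})\}_{k\in\mathbb{N}}$ be the set of eigenvalues and eigenfunctions of $(-\Delta)_\delta^s$ with homogeneous Dirichlet boundary condition on $\partial_\delta\Omega$, for $\delta>0$, and let $\{(\lambda_k^{\infty,s},\varphi_k^{\infty,s})\}_{k\in\mathbb{N}}$ be the set of eigenvalues and eigenfunctions of the fractional Laplacian $(-\Delta)_\infty^s$ with homogeneous Dirichlet boundary condition on $\mathbb{R}^N\setminus\Omega$. Then $$\lambda_k^{\delta,s}\to\lambda_k^{\infty,s}\qquad\text{as }\delta\to+\infty,$$ and there exists a subsequence (not relabelled) such that $$\varphi_k^{\delta,s}\to\varphi_k^{\infty,s}\ \text{ in }L^2(\Omega)\qquad\text{as }\delta\to+\infty,$$ for every $k\in\mathbb{N}$. As a consequence, $m_k^{\delta,s}\to m_k^{\infty,s}$ as $\delta\to+\infty$, for any $k\ge1$, where $m_k^{\delta,s}$ and $m_k^{\infty,s}$ denote the multiplicities of the eigenvalues $\lambda_k^{\delta,s}$ and $\lambda_k^{\infty,s}$ respectively.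
   Context: For $\delta>0$: $\partial_\delta\Omega=\{y\in\mathbb{R}^N\setminus\Omega:\ |x-y|<\delta\text{ for some }x\in\Omega\}$ and $\Omega_\delta=\Omega\cup\partial_\delta\Omega$. The constant is $c_{N,s}=\dfrac{2^{2s}s\,\Gamma(\frac N2+s)}{\pi^{N/2}\Gamma(1-s)}$. The operators are $(-\Delta)_\delta^s u(x)=c_{N,s}\,\mathrm{P.V.}\int_{B(x,\delta)}\frac{u(x)-u(y)}{|x-y|^{N+2s}}dy$ and $(-\Delta)_\infty^s u(x)=c_{N,s}\,\mathrm{P.V.}\int_{\mathbb{R}^N}\frac{u(x)-u(y)}{|x-y|^{N+2s}}dy$. The space $\mathbb{H}_0^{\delta,s}(\Omega)$ is the set of $v\in L^2(\Omega_\delta)$ with $v=0$ on $\partial_\delta\Omega$ and $\int_{\Omega_\delta}\int_{\Omega_\delta\cap B(x,\delta)}\frac{|v(x)-v(y)|^2}{|x-y|^{N+2s}}dydx<\infty$. The space $\mathcal{H}_0^s(\Omega)$ is the set of $v\in L^2(\mathbb{R}^N)$ with $\int_{\mathbb{R}^N}\int_{\mathbb{R}^N}\frac{|v(x)-v(y)|^2}{|x-y|^{N+2s}}dydx<\infty$ and $v=0$ a.e. on $\mathbb{R}^N\setminus\Omega$. An eigenvalue of $(-\Delta)_\delta^s$ with homogeneous Dirichlet condition on $\partial_\delta\Omega$ is $\lambda\in\mathbb{R}$ for which there is $0\ne\varphi\in\mathbb{H}_0^{\delta,s}(\Omega)$ (an eigenfunction) such that for all $v\in\mathbb{H}_0^{\delta,s}(\Omega)$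 $$\frac{c_{N,s}}{2}\int_{\Omega_\delta}\int_{\Omega_\delta\cap B(x,\delta)}\frac{(\varphi(x)-\varphi(y))(v(x)-v(y))}{|x-y|^{N+2s}}\,dy\,dx=\lambda\int_\Omega\varphi v\,dx .$$ These eigenvalues are listed, repeated according to multiplicity, as $0<\lambda_1^{\delta,s}<\lambda_2^{\delta,s}\le\dots\le\lambda_k^{\delta,s}\le\cdots\to+\infty$, and $\{\varphi_k^{\delta,s}\}_k$ are corresponding eigenfunctions forming an orthogonal basis of $\mathbb{H}_0^{\delta,s}(\Omega)$ and an orthonormal basis of $L^2(\Omega)$, with $\varphi_1^{\delta,s}\ge0$. Eigenvalues and eigenfunctions of $(-\Delta)_\infty^s$ with homogeneous Dirichlet condition on $\mathbb{R}^N\setminus\Omega$ are defined in the same way, with $\mathbb{H}_0^{\delta,s}(\Omega)$ replaced by $\mathcal{H}_0^s(\Omega)$ and the double integral taken over $\mathbb{R}^N\times\mathbb{R}^N$; the eigenvalues are listed, repeated according to multiplicity, as $0<\lambda_1^{\infty,s}<\lambda_2^{\infty,s}\le\dots\le\lambda_k^{\infty,s}\le\cdots\to+\infty$, and $\{\varphi_k^{\infty,s}\}_k$ are corresponding eigenfunctions forming an orthogonal basis of $\mathcal{H}_0^s(\Omega)$ and an orthonormal basis of $L^2(\Omega)$, with $\varphi_1^{\infty,s}$ chosen so that $\varphi_1^{\infty,s}\ge0$ in $\Omega$. The multiplicity of an eigenvalue is the dimension of its eigenspace, which is finite.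
   Formalization: The limit eigenfunctions φ_k^∞ are not fixed in advance: for each sequence δ_j→∞ some subsequence converges to some eigenfunction basis with all the stated properties. For a prescribed basis the claim fails (take φ_k^δ=−φ_k^∞, k≥2, δ large). *)

theory Defs
  imports "HOL-Analysis.Analysis"
begin

(* Near every boundary point the set is the strict epigraph of a Lipschitz function g over
   the hyperplane orthogonal to a unit vector e; x - (x \<bullet> e) *\<^sub>R e is the projection of x
   onto that hyperplane. *)
definition lipschitz_boundary :: "(real^'n) set \<Rightarrow> bool" where
  "lipschitz_boundary \<Omega> \<longleftrightarrow>
    (\<forall>p\<in>frontier \<Omega>. \<exists>r>0. \<exists>e g L. norm e = 1 \<and> L-lipschitz_on {z. z \<bullet> e = 0} g \<and>
       \<Omega> \<inter> ball p r = {x \<in> ball p r. g (x - (x \<bullet> e) *\<^sub>R e) < x \<bullet> e})"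

definition nonlocal_boundary :: "(real^'n) set \<Rightarrow> real \<Rightarrow> (real^'n) set" where
  "nonlocal_boundary \<Omega> \<delta> = {y \<in> - \<Omega>. \<exists>x\<in>\<Omega>. norm (x - y) < \<delta>}"

definition enlarged :: "(real^'n) set \<Rightarrow> real \<Rightarrow> (real^'n) set" where
  "enlarged \<Omega> \<delta> = \<Omega> \<union> nonlocal_boundary \<Omega> \<delta>"

definition frac_const :: "nat \<Rightarrow> real \<Rightarrow> real" where
  "frac_const N s =
    2 powr (2 * s) * s * Gamma (real N / 2 + s) / (pi powr (real N / 2) * Gamma (1 - s))"

(* Elements of L^2(D) are represented by functions on the whole space whose values outside D
   are irrelevant; equality in L^2(D) is equality almost everywhere with respect to
   lebesgue_on D. *)
definition L2 :: "(real^'n) set \<Rightarrow> (real^'n \<Rightarrow> real) set" where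
  "L2 D = {v \<in> borel_measurable (lebesgue_on D). integrable (lebesgue_on D) (\<lambda>x. (v x)\<^sup>2)}"

definition L2_inner :: "(real^'n) set \<Rightarrow> (real^'n \<Rightarrow> real) \<Rightarrow> (real^'n \<Rightarrow> real) \<Rightarrow> real" where
  "L2_inner D u v = (\<integral>x. u x * v x \<partial>lebesgue_on D)"

(* In what follows the pair (D, B) is
     (enlarged \<Omega> \<delta>, \<lambda>x. ball x \<delta>)  for the operator with horizon \<delta>, and
     (UNIV, \<lambda>x. UNIV)               for the fractional Laplacian on the whole space.
   For the first pair, H0 is the space H_0^{\<delta>,s}(\<Omega>); for the second, it is H_0^s(\<Omega>).
   In both cases D - \<Omega> carries the homogeneous Dirichlet condition. *)

definition gagliardo ::
  "real \<Rightarrow> (real^'n) set \<Rightarrow> (real^'n \<Rightarrow> (real^'n) set) \<Rightarrow> (real^'n \<Rightarrow> real) \<Rightarrow> ennreal" where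
  "gagliardo s D B v =
    (\<integral>\<^sup>+x. (\<integral>\<^sup>+y. ennreal (\<bar>v x - v y\<bar>\<^sup>2 / norm (x - y) powr (real CARD('n) + 2 * s))
        \<partial>lebesgue_on (D \<inter> B x)) \<partial>lebesgue_on D)"

definition H0 ::
  "(real^'n) set \<Rightarrow> real \<Rightarrow> (real^'n) set \<Rightarrow> (real^'n \<Rightarrow> (real^'n) set) \<Rightarrow> (real^'n \<Rightarrow> real) set" where
  "H0 \<Omega> s D B =
    {v \<in> L2 D. gagliardo s D B v < \<infinity> \<and> (AE x in lebesgue_on (D - \<Omega>). v x = 0)}"

definition energy_form ::
  "real \<Rightarrow> (real^'n) set \<Rightarrow> (real^'n \<Rightarrow> (real^'n) set) \<Rightarrow>
   (real^'n \<Rightarrow> real) \<Rightarrow> (real^'n \<Rightarrow> real) \<Rightarrow> real" where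
  "energy_form s D B u v =
    frac_const CARD('n) s / 2 *
    (\<integral>x. (\<integral>y. (u x - u y) * (v x - v y) / norm (x - y) powr (real CARD('n) + 2 * s)
        \<partial>lebesgue_on (D \<inter> B x)) \<partial>lebesgue_on D)"

definition eigenspace ::
  "(real^'n) set \<Rightarrow> real \<Rightarrow> (real^'n) set \<Rightarrow> (real^'n \<Rightarrow> (real^'n) set) \<Rightarrow> real \<Rightarrow>
   (real^'n \<Rightarrow> real) set" where
  "eigenspace \<Omega> s D B \<mu> =
    {\<phi> \<in> H0 \<Omega> s D B. \<forall>v\<in>H0 \<Omega> s D B. energy_form s D B \<phi> v = \<mu> * L2_inner \<Omega> \<phi> v}"

definition is_eigenfunction ::
  "(real^'n) set \<Rightarrow> real \<Rightarrow> (real^'n) set \<Rightarrow> (real^'n \<Rightarrow> (real^'n) set) \<Rightarrow> real \<Rightarrow>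
   (real^'n \<Rightarrow> real) \<Rightarrow> bool" where
  "is_eigenfunction \<Omega> s D B \<mu> \<phi> \<longleftrightarrow>
    \<phi> \<in> eigenspace \<Omega> s D B \<mu> \<and> \<not> (AE x in lebesgue_on D. \<phi> x = 0)"

definition is_eigenvalue ::
  "(real^'n) set \<Rightarrow> real \<Rightarrow> (real^'n) set \<Rightarrow> (real^'n \<Rightarrow> (real^'n) set) \<Rightarrow> real \<Rightarrow> bool" where
  "is_eigenvalue \<Omega> s D B \<mu> \<longleftrightarrow> (\<exists>\<phi>. is_eigenfunction \<Omega> s D B \<mu> \<phi>)"

(* Bases and dimension of a space of functions modulo almost everywhere equality. *)
definition ae_basis ::
  "'a measure \<Rightarrow> ('a \<Rightarrow> real) set \<Rightarrow> nat \<Rightarrow> (nat \<Rightarrow> 'a \<Rightarrow> real) \<Rightarrow> bool" where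
  "ae_basis M V n e \<longleftrightarrow>
    (\<forall>i<n. e i \<in> V) \<and>
    (\<forall>c. (AE x in M. (\<Sum>i<n. c i * e i x) = 0) \<longrightarrow> (\<forall>i<n. c i = 0)) \<and>
    (\<forall>v\<in>V. \<exists>c. AE x in M. v x = (\<Sum>i<n. c i * e i x))"

definition ae_finite_dim :: "'a measure \<Rightarrow> ('a \<Rightarrow> real) set \<Rightarrow> bool" where
  "ae_finite_dim M V \<longleftrightarrow> (\<exists>n e. ae_basis M V n e)"

definition ae_dim :: "'a measure \<Rightarrow> ('a \<Rightarrow> real) set \<Rightarrow> nat" where
  "ae_dim M V = (THE n. \<exists>e. ae_basis M V n e)"

definition eigen_multiplicity ::
  "(real^'n) set \<Rightarrow> real \<Rightarrow> (real^'n) set \<Rightarrow> (real^'n \<Rightarrow> (real^'n) set) \<Rightarrow> real \<Rightarrow> nat" where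
  "eigen_multiplicity \<Omega> s D B \<mu> = ae_dim (lebesgue_on D) (eigenspace \<Omega> s D B \<mu>)"

(* The list of all eigenvalues, repeated according to multiplicity. Numbering starts at 0, so
   lam k is the (k+1)-st eigenvalue. *)
definition eigenvalue_listing ::
  "(real^'n) set \<Rightarrow> real \<Rightarrow> (real^'n) set \<Rightarrow> (real^'n \<Rightarrow> (real^'n) set) \<Rightarrow> (nat \<Rightarrow> real) \<Rightarrow> bool" where
  "eigenvalue_listing \<Omega> s D B lam \<longleftrightarrow>
    0 < lam 0 \<and> lam 0 < lam 1 \<and> mono lam \<and> filterlim lam at_top sequentially \<and>
    range lam = {\<mu>. is_eigenvalue \<Omega> s D B \<mu>} \<and>
    (\<forall>k. ae_finite_dim (lebesgue_on D) (eigenspace \<Omega> s D B (lam k)) \<and>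
         card {j. lam j = lam k} = eigen_multiplicity \<Omega> s D B (lam k))"

(* Orthogonal basis in the Hilbert space sense: the finite linear combinations are dense. *)
definition orthogonal_basis ::
  "('a \<Rightarrow> real) set \<Rightarrow> (('a \<Rightarrow> real) \<Rightarrow> ('a \<Rightarrow> real) \<Rightarrow> real) \<Rightarrow> (nat \<Rightarrow> 'a \<Rightarrow> real) \<Rightarrow> bool" where
  "orthogonal_basis V ip e \<longleftrightarrow>
    (\<forall>i. e i \<in> V \<and> ip (e i) (e i) \<noteq> 0) \<and>
    (\<forall>i j. i \<noteq> j \<longrightarrow> ip (e i) (e j) = 0) \<and>
    (\<forall>v\<in>V. \<forall>\<epsilon>>0. \<exists>n c.
       ip (\<lambda>x. v x - (\<Sum>i<n. c i * e i x)) (\<lambda>x. v x - (\<Sum>i<n. c i * e i x)) < \<epsilon>)"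

definition orthonormal_basis ::
  "('a \<Rightarrow> real) set \<Rightarrow> (('a \<Rightarrow> real) \<Rightarrow> ('a \<Rightarrow> real) \<Rightarrow> real) \<Rightarrow> (nat \<Rightarrow> 'a \<Rightarrow> real) \<Rightarrow> bool" where
  "orthonormal_basis V ip e \<longleftrightarrow> orthogonal_basis V ip e \<and> (\<forall>i. ip (e i) (e i) = 1)"

(* H0 carries the inner product energy_form, a norm by the Poincare inequality. *)
definition eigenfunction_basis ::
  "(real^'n) set \<Rightarrow> real \<Rightarrow> (real^'n) set \<Rightarrow> (real^'n \<Rightarrow> (real^'n) set) \<Rightarrow> (nat \<Rightarrow> real) \<Rightarrow>
   (nat \<Rightarrow> real^'n \<Rightarrow> real) \<Rightarrow> bool" where
  "eigenfunction_basis \<Omega> s D B lam \<phi> \<longleftrightarrow>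
    (\<forall>k. is_eigenfunction \<Omega> s D B (lam k) (\<phi> k)) \<and>
    orthogonal_basis (H0 \<Omega> s D B) (energy_form s D B) \<phi> \<and>
    orthonormal_basis (L2 \<Omega>) (L2_inner \<Omega>) \<phi> \<and>
    (AE x in lebesgue_on \<Omega>. 0 \<le> \<phi> 0 x)"

end

theory Submission
  imports Defs "HOL-Complex_Analysis.Great_Picard"
begin

text \<open>Once \<open>\<delta>\<close> exceeds the diameter of \<open>\<Omega>\<close>, a function vanishing outside \<open>\<Omega>\<close> loses under truncation only
  the interactions of points of \<open>\<Omega>\<close> with points outside \<open>\<Omega>\<close> at distance at least \<open>\<delta>\<close>. Hence the two
  energies differ exactly by \<open>\<kappa>(\<delta>)\<close> times the inner product of \<open>L2 \<Omega>\<close>, where \<open>\<kappa>(\<delta>)\<close> is \<open>frac_const\<close> times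
  the integral of \<open>norm z powr - (N + 2 * s)\<close> over \<open>norm z \<ge> \<delta>\<close> and tends to 0. The eigenspaces therefore
  coincide, the eigenvalues are shifted by \<open>\<kappa>(\<delta>)\<close>, and the multiplicities agree. The eigenfunction bases
  for large \<open>\<delta>\<close> are orthonormal bases of the same finite-dimensional eigenspaces, so their coefficients
  with respect to one fixed basis have a convergent diagonal subsequence.\<close>

subsection \<open>Tail of the kernel and monotone sequences\<close>

text \<open>The spaces for different \<delta> consist of functions on different sets, determined off
  the domain only up to null sets, so the eigenspaces cannot be compared literally. All of them are
  moved by \<open>cutoff\<close> to one space \<open>core\<close> that does not depend on \<delta>
  and whose members vanish everywhere off the domain. The predicate
  \<open>realizes D B \<kappa>\<close> records that the problem for the pair \<open>(D, B)\<close>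
  is the whole-space energy on \<open>core\<close>, lowered by \<kappa> times the L2 inner product;
  eigenspaces, lists and bases are then treated once for any realization. The lost energy is an
  exact multiple of the L2 inner product, and not merely small, because the tail kernel integrated
  over one variable does not depend on the other one. The bases are the delicate point: inside a
  multiple eigenvalue the eigenfunctions for different \<delta> may be rotated arbitrarily, so the
  limit basis may depend on the subsequence. Completeness of the limit is not automatic; it comes
  from the limiting coefficient matrix having orthonormal rows and orthonormal columns.\<close>

lemma kernel_tail_le_dyadic_series:
  fixes z :: "'a::euclidean_space" and p \<delta> :: real
  assumes "0 < \<delta>" "0 < p"
  shows "ennreal (indicator {z. \<delta> \<le> norm z} z / norm z powr p)
    \<le> (\<Sum>j. ennreal ((2 ^ j * \<delta>) powr (- p)) * indicator (ball 0 (2 ^ Suc j * \<delta>)) z)"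
proof (cases "\<delta> \<le> norm z")
  case True
  have term_le: "f j \<le> suminf f" for f :: "nat \<Rightarrow> ennreal" and j
    using sum_le_suminf[of f "{j}"] by simp
  \<comment> \<open>The index of the dyadic shell containing \<open>z\<close>. The logarithm is
    nonnegative since \<open>norm z\<close> is at least \<delta>, so \<open>nat\<close> loses
    nothing.\<close>
  define j where "j = nat \<lfloor>log 2 (norm z / \<delta>)\<rfloor>"
  have q: "norm z / \<delta> \<ge> 1"
    using True assms by simp
  then have l: "log 2 (norm z / \<delta>) \<ge> 0"
    by simp
  have "real j \<le> log 2 (norm z / \<delta>)" "log 2 (norm z / \<delta>) < real (Suc j)"
    unfolding j_def using l by linarith+
  then have "2 powr real j \<le> norm z / \<delta>" "norm z / \<delta> < 2 powr real (Suc j)"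
    using q le_log_iff[of 2 "norm z / \<delta>" "real j"] log_less_iff[of 2 "norm z / \<delta>" "real (Suc j)"] by linarith+
  then have j: "2 ^ j * \<delta> \<le> norm z" "norm z < 2 ^ Suc j * \<delta>"
    using assms powr_realpow[of 2 j] powr_realpow[of 2 "Suc j"]
    by (simp_all only: pos_le_divide_eq pos_divide_less_eq zero_less_numeral)
  have "norm z powr (- p) \<le> (2 ^ j * \<delta>) powr (- p)"
    using assms j by (intro powr_mono2') auto
  then have "ennreal (indicator {z. \<delta> \<le> norm z} z / norm z powr p)
      \<le> ennreal ((2 ^ j * \<delta>) powr (- p)) * indicator (ball 0 (2 ^ Suc j * \<delta>)) z"
    using True j by (simp add: ennreal_leI divide_simps powr_minus del: power_Suc)
  also have "\<dots> \<le> (\<Sum>j. ennreal ((2 ^ j * \<delta>) powr (- p)) * indicator (ball 0 (2 ^ Suc j * \<delta>)) z)"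
    by (rule term_le)
  finally show ?thesis .
qed simp

text \<open>The volume of the j-th ball grows like \<open>(2 ^ j * \<delta>) ^ DIM('a)\<close> and
  cancels that part of the exponent, which leaves a geometric series of ratio
  \<open>2 powr (- a)\<close>.\<close>

lemma kernel_tail_bound:
  fixes a :: real
  assumes "0 < a"
  shows "\<exists>C\<ge>0. \<forall>\<delta>>0. (\<integral>\<^sup>+ (z :: 'a::euclidean_space).
    ennreal (indicator {z. \<delta> \<le> norm z} z / norm z powr (real DIM('a) + a)) \<partial>lborel)
      \<le> ennreal (C * \<delta> powr (- a))"
proof -
  define p where "p = real DIM('a) + a"
  have p: "0 < p"
    using assms by (simp add: p_def)
  \<comment> \<open>The balls have radius \<open>2 ^ Suc j * \<delta>\<close>, one doubling more
    than the base of the weight; the factor \<open>2 ^ DIM('a)\<close> accounts for it.\<close>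
  define V where "V = unit_ball_vol (real DIM('a)) * 2 ^ DIM('a)"
  have V: "V \<ge> 0"
    by (simp add: V_def)
  have r: "0 \<le> 2 powr (- a)" "2 powr (- a) < 1"
    using assms by (simp_all add: powr_less_one)
  have "(\<integral>\<^sup>+ (z :: 'a). ennreal (indicator {z. \<delta> \<le> norm z} z / norm z powr p) \<partial>lborel)
      \<le> ennreal (V * (1 / (1 - 2 powr (- a))) * \<delta> powr (- a))" if \<delta>: "0 < \<delta>" for \<delta>
  proof -
    have "(\<integral>\<^sup>+ (z :: 'a). ennreal (indicator {z. \<delta> \<le> norm z} z / norm z powr p) \<partial>lborel)
      \<le> (\<integral>\<^sup>+ (z :: 'a). (\<Sum>j. ennreal ((2 ^ j * \<delta>) powr (- p)) * indicator (ball 0 (2 ^ Suc j * \<delta>)) z) \<partial>lborel)"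
      by (rule nn_integral_mono) (rule kernel_tail_le_dyadic_series[OF \<delta> p])
    also have "\<dots> = (\<Sum>j. ennreal ((2 ^ j * \<delta>) powr (- p)) * emeasure lborel (ball (0::'a) (2 ^ Suc j * \<delta>)))"
    proof (subst nn_integral_suminf)
      show "(\<lambda>z :: 'a. ennreal ((2 ^ j * \<delta>) powr (- p)) * indicator (ball 0 (2 ^ Suc j * \<delta>)) z)
          \<in> borel_measurable lborel" for j
        by (intro borel_measurable_times_ennreal borel_measurable_const borel_measurable_indicator) simp
    qed (intro suminf_cong nn_integral_cmult_indicator, simp)
    also have "\<dots> = (\<Sum>j. ennreal (V * \<delta> powr (- a) * (2 powr (- a)) ^ j))"
    proof (intro suminf_cong)
      fix j
      have "(2 ^ j * \<delta>) powr (- p) * (unit_ball_vol (real DIM('a)) * (2 ^ Suc j * \<delta>) ^ DIM('a))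
          = V * ((2 ^ j * \<delta>) powr (- p) * (2 ^ j * \<delta>) ^ DIM('a))"
        by (simp add: V_def power_mult_distrib)
      also have "(2 ^ j * \<delta>) ^ DIM('a) = (2 ^ j * \<delta>) powr real DIM('a)"
        using \<delta> by (simp add: powr_realpow)
      also have "(2 ^ j * \<delta>) powr (- p) * (2 ^ j * \<delta>) powr real DIM('a) = (2 ^ j * \<delta>) powr (- a)"
        by (simp add: p_def flip: powr_add)
      also have "\<dots> = (2 powr (- a)) ^ j * \<delta> powr (- a)"
      proof -
        have "(2 ^ j :: real) powr (- a) = (2 powr (- a)) ^ j"
          by (simp add: powr_powr powr_power mult.commute flip: powr_realpow[of 2 j])
        then show ?thesis
          using \<delta> by (simp add: powr_mult)
      qed
      finally show "ennreal ((2 ^ j * \<delta>) powr (- p)) * emeasure lborel (ball (0::'a) (2 ^ Suc j * \<delta>))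
          = ennreal (V * \<delta> powr (- a) * (2 powr (- a)) ^ j)"
        using \<delta> by (simp add: emeasure_ball mult_ac flip: ennreal_mult)
    qed
    also have "\<dots> = ennreal (V * \<delta> powr (- a) * (1 / (1 - 2 powr (- a))))"
      using V r by (intro suminf_ennreal_eq sums_mult geometric_sums) auto
    finally show ?thesis
      by (simp add: mult_ac)
  qed
  moreover have "V * (1 / (1 - 2 powr (- a))) \<ge> 0"
    using V r by simp
  ultimately show ?thesis
    unfolding p_def by blast
qed

text \<open>A nondecreasing sequence tending to infinity is recovered from its counting function,
  the number of indices with value at most \<open>x\<close>, and that function depends only on the
  values and their multiplicities. This is how two lists of eigenvalues get identified term by
  term.\<close>

lemma mono_eq_if_level_cards_eq:
  fixes f g :: "nat \<Rightarrow> real"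
  assumes f: "mono f" "filterlim f at_top sequentially"
    and g: "mono g" "filterlim g at_top sequentially"
    and "range f = range g"
    and card: "\<And>y. card {j. f j = y} = card {j. g j = y}"
  shows "f = g"
proof -
  \<comment> \<open>Sublevel sets are initial segments, so each one is determined by its
    cardinality.\<close>
  have fin: "\<exists>n. {j. h j \<le> x} = {..<n}" if "mono h" and lim: "filterlim h at_top sequentially" for h :: "nat \<Rightarrow> real" and x
  proof -
    define m where "m = (LEAST n. x < h n)"
    have "eventually (\<lambda>n. x < h n) sequentially"
      using lim by (simp add: filterlim_at_top_dense)
    then have m: "x < h m"
      unfolding m_def by (rule LeastI_ex[OF eventually_happens'[OF sequentially_bot]])
    have "h j \<le> x \<longleftrightarrow> j < m" for j
    proof
      show "j < m" if "h j \<le> x"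
        using that m monoD[OF \<open>mono h\<close>, of m j] by (cases "j < m") auto
      show "h j \<le> x" if "j < m"
        using not_less_Least[of j "\<lambda>n. x < h n"] that by (simp add: m_def not_less)
    qed
    then have "{j. h j \<le> x} = {..<m}"
      by auto
    then show ?thesis
      by blast
  qed
  have count: "card {j. h j \<le> x} = (\<Sum>y\<in>range h \<inter> {..x}. card {j. h j = y})"
    if "mono h" and lim: "filterlim h at_top sequentially" for h :: "nat \<Rightarrow> real" and x
  proof -
    obtain n where n: "{j. h j \<le> x} = {..<n}"
      using fin[OF \<open>mono h\<close> lim] by blast
    \<comment> \<open>Cardinalities add up only over a finite family of finite sets; divergence to
      infinity supplies both kinds of finiteness.\<close>
    have "finite {j. h j = y}" if "y \<in> range h \<inter> {..x}" for y
    proof (rule finite_subset)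
      show "{j. h j = y} \<subseteq> {..<n}"
        using that unfolding n[symmetric] by auto
    qed simp
    moreover have "finite (range h \<inter> {..x})"
    proof (rule finite_subset)
      show "range h \<inter> {..x} \<subseteq> h ` {..<n}"
        unfolding n[symmetric] by auto
    qed simp
    ultimately have "card (\<Union>y\<in>range h \<inter> {..x}. {j. h j = y}) = (\<Sum>y\<in>range h \<inter> {..x}. card {j. h j = y})"
      by (intro card_UN_disjoint) (assumption, blast, blast)
    moreover have "(\<Union>y\<in>range h \<inter> {..x}. {j. h j = y}) = {j. h j \<le> x}"
      by auto
    ultimately show ?thesis
      by (simp only:)
  qed
  have sub: "{j. f j \<le> x} = {j. g j \<le> x}" for x
  proof -
    obtain m n where "{j. f j \<le> x} = {..<m}" "{j. g j \<le> x} = {..<n}"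
      using fin f g by meson
    moreover have "card {j. f j \<le> x} = card {j. g j \<le> x}"
      using count[OF f] count[OF g] assms by simp
    ultimately show ?thesis
      by simp
  qed
  have "g j \<le> f j" "f j \<le> g j" for j
    using sub[of "f j"] sub[of "g j"] by auto
  then show ?thesis
    by (intro ext antisym) auto
qed

subsection \<open>Semi-inner products on function spaces\<close>

text \<open>Members are concrete functions rather than classes modulo null sets, so
  \<open>ip u u = 0\<close> need not mean \<open>u = 0\<close>, and the laws are required only on
  \<open>V\<close>. It is used for L2, for the whole-space energy and for the truncated
  energy.\<close>

locale semi_inner_product =
  fixes V :: "('a \<Rightarrow> real) set" and ip :: "('a \<Rightarrow> real) \<Rightarrow> ('a \<Rightarrow> real) \<Rightarrow> real"
  assumes zero_closed: "(\<lambda>x. 0) \<in> V"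
    and lincomb_closed: "\<And>u v a b. u \<in> V \<Longrightarrow> v \<in> V \<Longrightarrow> (\<lambda>x. a * u x + b * v x) \<in> V"
    and ip_sym: "\<And>u v. u \<in> V \<Longrightarrow> v \<in> V \<Longrightarrow> ip u v = ip v u"
    and ip_lincomb: "\<And>u v w a b. u \<in> V \<Longrightarrow> v \<in> V \<Longrightarrow> w \<in> V \<Longrightarrow>
      ip (\<lambda>x. a * u x + b * v x) w = a * ip u w + b * ip v w"
    and ip_nonneg: "\<And>u. u \<in> V \<Longrightarrow> 0 \<le> ip u u"
begin

lemma sum_closed:
  fixes n :: nat
  shows "(\<And>i. i < n \<Longrightarrow> e i \<in> V) \<Longrightarrow> (\<lambda>x. \<Sum>i<n. c i * e i x) \<in> V"
proof (induction n)
  case (Suc n)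
  then show ?case
    using lincomb_closed[of "\<lambda>x. \<Sum>i<n. c i * e i x" "e n" 1 "c n"] by simp
qed (simp add: zero_closed)

lemma diff_closed:
  "u \<in> V \<Longrightarrow> v \<in> V \<Longrightarrow> (\<lambda>x. u x - v x) \<in> V"
  using lincomb_closed[of u v 1 "-1"] by simp

lemma ip_zero: "w \<in> V \<Longrightarrow> ip (\<lambda>x. 0) w = 0"
  using ip_lincomb[of "\<lambda>x. 0" "\<lambda>x. 0" w 0 0] zero_closed by simp

lemma ip_sum:
  fixes n :: nat
  shows "(\<And>i. i < n \<Longrightarrow> e i \<in> V) \<Longrightarrow> w \<in> V \<Longrightarrow> ip (\<lambda>x. \<Sum>i<n. c i * e i x) w = (\<Sum>i<n. c i * ip (e i) w)"
proof (induction n)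
  case (Suc n)
  then show ?case
    using ip_lincomb[of "\<lambda>x. \<Sum>i<n. c i * e i x" "e n" w 1 "c n"] sum_closed[of n e c] by simp
qed (simp add: ip_zero)

lemma ip_sum_right:
  fixes n :: nat
  shows "(\<And>i. i < n \<Longrightarrow> e i \<in> V) \<Longrightarrow> w \<in> V \<Longrightarrow> ip w (\<lambda>x. \<Sum>i<n. c i * e i x) = (\<Sum>i<n. c i * ip w (e i))"
  by (subst ip_sym) (auto simp: sum_closed ip_sum ip_sym intro!: sum.cong)

lemma ip_diff:
  "u \<in> V \<Longrightarrow> v \<in> V \<Longrightarrow> w \<in> V \<Longrightarrow> ip (\<lambda>x. u x - v x) w = ip u w - ip v w"
  using ip_lincomb[of u v w 1 "-1"] by simp

lemma ip_diff_right:
  "u \<in> V \<Longrightarrow> v \<in> V \<Longrightarrow> w \<in> V \<Longrightarrow> ip w (\<lambda>x. u x - v x) = ip w u - ip w v"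
  using ip_diff[of u v w] ip_sym diff_closed by metis

lemma ip_diff_self:
  "u \<in> V \<Longrightarrow> v \<in> V \<Longrightarrow> ip (\<lambda>x. u x - v x) (\<lambda>x. u x - v x) = ip u u - 2 * ip u v + ip v v"
  by (simp add: ip_diff ip_diff_right diff_closed ip_sym)

text \<open>Orthogonality decouples the squared distance into one quadratic polynomial per
  coefficient, so the coefficients can be optimised separately.\<close>

lemma ip_diff_sum_self:
  fixes e :: "nat \<Rightarrow> 'a \<Rightarrow> real"
  assumes e: "\<And>i. e i \<in> V" "\<And>i j. i \<noteq> j \<Longrightarrow> ip (e i) (e j) = 0" and v: "v \<in> V"
  shows "ip (\<lambda>x. v x - (\<Sum>i<n. c i * e i x)) (\<lambda>x. v x - (\<Sum>i<n. c i * e i x))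
    = ip v v - (\<Sum>i<n. 2 * c i * ip v (e i) - (c i)\<^sup>2 * ip (e i) (e i))"
proof -
  have "(\<Sum>j<n. c j * ip (e i) (e j)) = c i * ip (e i) (e i)" if "i < n" for i
    using that e(2) by (subst sum.remove[of _ i]) (auto intro!: sum.neutral)
  then have "(\<Sum>i<n. c i * (\<Sum>j<n. c j * ip (e i) (e j))) = (\<Sum>i<n. (c i)\<^sup>2 * ip (e i) (e i))"
    by (intro sum.cong) (auto simp: power2_eq_square)
  moreover have "(\<Sum>i<n. 2 * c i * ip v (e i)) = 2 * (\<Sum>i<n. c i * ip v (e i))"
    by (simp add: sum_distrib_left mult.assoc)
  ultimately show ?thesis
    using e v by (simp add: ip_diff_self sum_closed ip_sum ip_sum_right sum_subtractf)
qed

text \<open>Each quadratic is largest at the Fourier coefficient and nonnegative there, so taking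
  Fourier coefficients and adding terms both help. The coefficients enter through an equation so
  that one sequence \<open>f\<close> can serve two inner products at once.\<close>

lemma fourier_best_approx:
  fixes e :: "nat \<Rightarrow> 'a \<Rightarrow> real"
  assumes e: "\<And>i. e i \<in> V" "\<And>i j. i \<noteq> j \<Longrightarrow> ip (e i) (e j) = 0" "\<And>i. 0 < ip (e i) (e i)"
    and v: "v \<in> V" and f: "\<And>i. f i * ip (e i) (e i) = ip v (e i)" and "n \<le> N"
  shows "ip (\<lambda>x. v x - (\<Sum>i<N. f i * e i x)) (\<lambda>x. v x - (\<Sum>i<N. f i * e i x))
    \<le> ip (\<lambda>x. v x - (\<Sum>i<n. c i * e i x)) (\<lambda>x. v x - (\<Sum>i<n. c i * e i x))"
proof -
  let ?q = "\<lambda>c i. 2 * c i * ip v (e i) - (c i)\<^sup>2 * ip (e i) (e i)"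
  have "?q c i \<le> ?q f i" for i
  proof -
    have "?q f i - ?q c i = (f i - c i)\<^sup>2 * ip (e i) (e i)"
      by (simp add: f[symmetric] power2_eq_square algebra_simps)
    then show ?thesis
      using e(3)[of i] by (smt (verit) zero_le_power2 mult_nonneg_nonneg)
  qed
  moreover have "0 \<le> ?q f i" for i
    using e(3)[of i] mult_nonneg_nonneg[of "(f i)\<^sup>2" "ip (e i) (e i)"]
    by (simp add: f[symmetric] power2_eq_square mult_ac)
  ultimately have "(\<Sum>i<n. ?q c i) \<le> (\<Sum>i<N. ?q f i)"
    using \<open>n \<le> N\<close> by (intro order_trans[OF sum_mono sum_mono2]) auto
  then show ?thesis
    using ip_diff_sum_self[OF e(1,2) v] by simp
qed

lemma ip_null:
  assumes u: "u \<in> V" "ip u u = 0" and w: "w \<in> V"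
  shows "ip u w = 0"
proof (rule ccontr)
  assume nz: "ip u w \<noteq> 0"
  \<comment> \<open>If \<open>ip u w\<close> were nonzero, the square of \<open>w - t * u\<close>
    would be affine in \<open>t\<close>, since \<open>ip u u = 0\<close>. This \<open>t\<close>
    makes it equal to -1.\<close>
  define t where "t = (ip w w + 1) / (2 * ip u w)"
  define z where "z = (\<lambda>x. 1 * w x + (- t) * u x)"
  have z: "z \<in> V"
    unfolding z_def using u w by (intro lincomb_closed)
  have zy: "ip z y = ip w y - t * ip u y" if "y \<in> V" for y
    unfolding z_def using ip_lincomb[OF w u(1) that, of 1 "- t"] by simp
  have "ip z z = ip z w - t * ip z u"
    using zy[OF z] ip_sym[OF w z] ip_sym[OF u(1) z] by simp
  also have "\<dots> = ip w w - 2 * (t * ip u w)"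
    using zy[OF w] zy[OF u(1)] ip_sym[OF w u(1)] u(2) by simp
  also have "2 * (t * ip u w) = ip w w + 1"
    using nz by (simp add: t_def)
  finally show False
    using ip_nonneg[OF z] by simp
qed

text \<open>Cauchy-Schwarz for unit vectors, read off from the squares of \<open>u - v\<close> and
  \<open>u + v\<close>. It bounds the coefficients to which compactness is applied.\<close>

lemma ip_le_one:
  assumes "u \<in> V" "v \<in> V" "ip u u = 1" "ip v v = 1"
  shows "\<bar>ip u v\<bar> \<le> 1"
proof -
  have "0 \<le> ip (\<lambda>x. u x - v x) (\<lambda>x. u x - v x)"
    using assms by (intro ip_nonneg diff_closed)
  moreover have v': "(\<lambda>x. - v x) \<in> V"
    using lincomb_closed[of v v 0 "-1"] assms by simp
  have iv: "ip (\<lambda>x. - v x) w = - ip v w" if "w \<in> V" for w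
    using ip_lincomb[of v v w 0 "-1"] assms that by simp
  have "0 \<le> ip (\<lambda>x. u x - - v x) (\<lambda>x. u x - - v x)"
    using assms v' by (intro ip_nonneg diff_closed)
  moreover have "ip u (\<lambda>x. - v x) = - ip u v" "ip (\<lambda>x. - v x) (\<lambda>x. - v x) = ip v v"
    using iv[of u] iv[of "\<lambda>x. - v x"] iv[of v] assms v' ip_sym by auto
  ultimately show ?thesis
    using ip_diff_self[OF assms(1,2)] ip_diff_self[OF assms(1) v'] assms by simp
qed

end

subsection \<open>Energies as integrals over pairs\<close>

text \<open>The functions involved are only Lebesgue measurable, so pairs carry the product of the
  completed measures: for it \<open>increment u\<close> is measurable whenever \<open>u\<close>
  is.\<close>

abbreviation lebesgue_pair :: "((real^'n) \<times> (real^'n)) measure" where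
  "lebesgue_pair \<equiv> lebesgue \<Otimes>\<^sub>M lebesgue"

lemma pair_sigma_finite_lebesgue:
  "pair_sigma_finite (lebesgue :: (real^'n) measure) (lebesgue :: (real^'n) measure)"
proof -
  obtain A :: "(real^'n) set set" where A: "countable A" "A \<subseteq> sets lborel" "\<Union>A = space lborel" "\<forall>a\<in>A. emeasure lborel a \<noteq> \<infinity>"
    using lborel.sigma_finite_countable by blast
  interpret sigma_finite_measure "lebesgue :: (real^'n) measure"
  proof (standard, intro exI[of _ A] conjI ballI)
    show "A \<subseteq> sets lebesgue"
      using A by auto
    show "emeasure lebesgue a \<noteq> \<infinity>" if "a \<in> A" for a
      using A that by (auto simp: subset_iff)
  qed (use A in auto)
  show ?thesis ..
qed

interpretation leb2: pair_sigma_finite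
  "lebesgue :: (real^'n) measure" "lebesgue :: (real^'n) measure"
  by (rule pair_sigma_finite_lebesgue)

text \<open>On the diagonal the value is 1 / 0 = 0.\<close>

definition frac_kernel :: "real \<Rightarrow> (real^'n) \<times> (real^'n) \<Rightarrow> real" where
  "frac_kernel s z = 1 / norm (fst z - snd z) powr (real CARD('n) + 2 * s)"

definition increment :: "('a \<Rightarrow> real) \<Rightarrow> 'a \<times> 'a \<Rightarrow> real" where
  "increment u z = u (fst z) - u (snd z)"

definition cutoff :: "'a set \<Rightarrow> ('a \<Rightarrow> real) \<Rightarrow> 'a \<Rightarrow> real" where
  "cutoff A u x = (if x \<in> A then u x else 0)"

lemma measurable_fst_lebesgue [measurable]: "fst \<in> lebesgue_pair \<rightarrow>\<^sub>M lebesgue"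
  and measurable_snd_lebesgue [measurable]: "snd \<in> lebesgue_pair \<rightarrow>\<^sub>M lebesgue"
  by simp_all

lemma measurable_id_lebesgue [measurable]: "(\<lambda>x. x) \<in> lebesgue \<rightarrow>\<^sub>M (borel :: (real^'n) measure)"
  by (simp add: measurable_completion)

lemma measurable_fst_borel [measurable]: "fst \<in> borel_measurable (lebesgue_pair :: ((real^'n) \<times> (real^'n)) measure)"
  using measurable_compose[OF measurable_fst_lebesgue measurable_id_lebesgue] by simp

lemma measurable_snd_borel [measurable]: "snd \<in> borel_measurable (lebesgue_pair :: ((real^'n) \<times> (real^'n)) measure)"
  using measurable_compose[OF measurable_snd_lebesgue measurable_id_lebesgue] by simp

lemma measurable_frac_kernel [measurable]: "frac_kernel s \<in> borel_measurable lebesgue_pair"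
  unfolding frac_kernel_def[abs_def] by measurable

lemma measurable_increment [measurable]:
  assumes [measurable]: "u \<in> borel_measurable lebesgue"
  shows "increment u \<in> borel_measurable (lebesgue_pair :: ((real^'n) \<times> (real^'n)) measure)"
  unfolding increment_def[abs_def] by measurable

lemma frac_kernel_nonneg [simp]: "0 \<le> frac_kernel s z"
  by (simp add: frac_kernel_def)

lemma measurable_cutoff_iff:
  "A \<in> sets lebesgue \<Longrightarrow> cutoff A u \<in> borel_measurable lebesgue \<longleftrightarrow> u \<in> borel_measurable (lebesgue_on A)"
  by (simp add: borel_measurable_restrict_space_iff, intro measurable_cong)
     (auto simp: cutoff_def split: split_indicator)

lemma AE_pair_cong:
  fixes u u' :: "real^'n \<Rightarrow> real"
  assumes [measurable]: "u \<in> borel_measurable lebesgue" "u' \<in> borel_measurable lebesgue"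
    and ae: "AE x in lebesgue. u x = u' x"
  shows "AE z in lebesgue_pair. increment u z = increment u' z"
proof (rule leb2.AE_pair_measure)
  show "{z \<in> space lebesgue_pair. increment u z = increment u' z} \<in> sets lebesgue_pair"
    by measurable
  show "AE x in lebesgue. AE y in lebesgue. increment u (x, y) = increment u' (x, y)"
    using ae by eventually_elim (use ae in eventually_elim, simp add: increment_def)
qed

text \<open>The iterated domain of integration is encoded as one measurable set \<open>S\<close> of
  pairs, so that seminorm and energy become single integrals against the indicator of
  \<open>S\<close> and different horizons differ only in \<open>S\<close>.\<close>

locale interaction_region =
  fixes D :: "(real^'n) set" and B :: "real^'n \<Rightarrow> (real^'n) set" and S :: "((real^'n) \<times> (real^'n)) set"
  assumes D [measurable]: "D \<in> sets lebesgue" and S [measurable]: "S \<in> sets lebesgue_pair"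
    and S_iff: "\<And>x y. (x, y) \<in> S \<longleftrightarrow> x \<in> D \<and> y \<in> D \<inter> B x"
begin

lemma section_sets: "x \<in> D \<Longrightarrow> D \<inter> B x \<in> sets lebesgue"
  using sets_Pair1[OF S, of x] by (simp add: vimage_def S_iff Int_def)

text \<open>Tonelli's theorem, applied to a globally measurable \<open>w\<close> because
  \<open>u\<close> is measurable on \<open>D\<close> only. Nonnegative integrals respect equality
  almost everywhere without measurability, so \<open>u\<close> is replaced first in the outer and
  then in the inner integral.\<close>

lemma gagliardo_eq_pair:
  assumes [measurable]: "w \<in> borel_measurable lebesgue"
    and u: "u \<in> borel_measurable (lebesgue_on D)" and ae: "AE x in lebesgue_on D. u x = w x"
  shows "gagliardo s D B u
    = (\<integral>\<^sup>+z. indicator S z * ennreal ((increment w z)\<^sup>2 * frac_kernel s z) \<partial>lebesgue_pair)"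
proof -
  have ae': "AE x in lebesgue. x \<in> D \<longrightarrow> u x = w x"
    using ae by (subst (asm) AE_restrict_space_iff) auto
  have "gagliardo s D B u = (\<integral>\<^sup>+x. (\<integral>\<^sup>+y. ennreal (\<bar>u x - u y\<bar>\<^sup>2 / norm (x - y) powr (real CARD('n) + 2 * s))
        \<partial>lebesgue_on (D \<inter> B x)) * indicator D x \<partial>lebesgue)"
    unfolding gagliardo_def by (subst nn_integral_restrict_space) auto
  also have "\<dots> = (\<integral>\<^sup>+x. (\<integral>\<^sup>+y. indicator S (x, y) *
      ennreal ((increment w (x, y))\<^sup>2 * frac_kernel s (x, y)) \<partial>lebesgue) \<partial>lebesgue)"
  proof (rule nn_integral_cong_AE, use ae' in eventually_elim)
    fix x assume x: "x \<in> D \<longrightarrow> u x = w x"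
    show "(\<integral>\<^sup>+y. ennreal (\<bar>u x - u y\<bar>\<^sup>2 / norm (x - y) powr (real CARD('n) + 2 * s))
        \<partial>lebesgue_on (D \<inter> B x)) * indicator D x = (\<integral>\<^sup>+y. indicator S (x, y) *
      ennreal ((increment w (x, y))\<^sup>2 * frac_kernel s (x, y)) \<partial>lebesgue)"
    proof (cases "x \<in> D")
      case True
      have "(\<integral>\<^sup>+y. ennreal (\<bar>u x - u y\<bar>\<^sup>2 / norm (x - y) powr (real CARD('n) + 2 * s)) \<partial>lebesgue_on (D \<inter> B x))
        = (\<integral>\<^sup>+y. ennreal (\<bar>u x - u y\<bar>\<^sup>2 / norm (x - y) powr (real CARD('n) + 2 * s)) * indicator (D \<inter> B x) y \<partial>lebesgue)"
        using section_sets[OF True] by (subst nn_integral_restrict_space) auto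
      also have "\<dots> = (\<integral>\<^sup>+y. indicator S (x, y) *
          ennreal ((increment w (x, y))\<^sup>2 * frac_kernel s (x, y)) \<partial>lebesgue)"
        by (rule nn_integral_cong_AE, use ae' in eventually_elim)
          (use x True in \<open>auto simp: S_iff increment_def frac_kernel_def split: split_indicator\<close>)
      finally show ?thesis
        using True by simp
    qed (simp add: S_iff)
  qed
  also have "\<dots> = (\<integral>\<^sup>+z. indicator S z * ennreal ((increment w z)\<^sup>2 * frac_kernel s z) \<partial>lebesgue_pair)"
    by (rule leb2.M1.nn_integral_fst) measurable
  finally show ?thesis .
qed

lemma energy_form_eq_pair:
  assumes [measurable]: "w \<in> borel_measurable lebesgue" "w' \<in> borel_measurable lebesgue"
    and u: "u \<in> borel_measurable (lebesgue_on D)" "AE x in lebesgue_on D. u x = w x"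
    and v: "v \<in> borel_measurable (lebesgue_on D)" "AE x in lebesgue_on D. v x = w' x"
    and int: "integrable lebesgue_pair (\<lambda>z. increment w z * increment w' z * frac_kernel s z)"
  shows "energy_form s D B u v = frac_const CARD('n) s / 2 *
    (\<integral>z. indicator S z * (increment w z * increment w' z * frac_kernel s z) \<partial>lebesgue_pair)"
proof -
  \<comment> \<open>Signed integrals respect equality almost everywhere only for measurable
    integrands. Hence \<open>u\<close> and \<open>v\<close> are first replaced by their cutoffs to
    \<open>D\<close>, which changes nothing at any point of \<open>S\<close>, and the passage to
    \<open>w\<close> and \<open>w'\<close> happens after Fubini, on pairs.\<close>
  have [measurable]: "cutoff D u \<in> borel_measurable lebesgue" "cutoff D v \<in> borel_measurable lebesgue"
    using u v by (simp_all add: measurable_cutoff_iff)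
  have [measurable]: "cutoff D w \<in> borel_measurable lebesgue" "cutoff D w' \<in> borel_measurable lebesgue"
    by (simp_all add: measurable_cutoff_iff measurable_restrict_space1)
  have "AE x in lebesgue. x \<in> D \<longrightarrow> u x = w x" "AE x in lebesgue. x \<in> D \<longrightarrow> v x = w' x"
    using u(2) v(2) by (simp_all add: AE_restrict_space_iff)
  then have "AE x in lebesgue. cutoff D u x = cutoff D w x" "AE x in lebesgue. cutoff D v x = cutoff D w' x"
    by (eventually_elim, simp add: cutoff_def)+
  then have "AE z in lebesgue_pair. increment (cutoff D u) z = increment (cutoff D w) z"
    "AE z in lebesgue_pair. increment (cutoff D v) z = increment (cutoff D w') z"
    by (simp_all add: AE_pair_cong)
  then have ae: "AE z in lebesgue_pair. 
      indicator S z * (increment w z * increment w' z * frac_kernel s z)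
      = indicator S z * (increment (cutoff D u) z * increment (cutoff D v) z * frac_kernel s z)"
    by eventually_elim (auto simp: S_iff cutoff_def increment_def split: split_indicator)
  have int': "integrable lebesgue_pair (\<lambda>z. indicator S z * (increment w z * increment w' z * frac_kernel s z))"
    using integrable_mult_indicator[OF S int] by simp
  then have int'': "integrable lebesgue_pair
      (\<lambda>z. indicator S z * (increment (cutoff D u) z * increment (cutoff D v) z * frac_kernel s z))"
    by (subst (asm) integrable_cong_AE[OF _ _ ae]) measurable
  have "(\<integral>x. (\<integral>y. (u x - u y) * (v x - v y) / norm (x - y) powr (real CARD('n) + 2 * s)
        \<partial>lebesgue_on (D \<inter> B x)) \<partial>lebesgue_on D)
    = (\<integral>x. indicator D x *\<^sub>R (\<integral>y. (u x - u y) * (v x - v y) / norm (x - y) powr (real CARD('n) + 2 * s)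
        \<partial>lebesgue_on (D \<inter> B x)) \<partial>lebesgue)"
    by (subst integral_restrict_space) auto
  also have "\<dots> = (\<integral>x. (\<integral>y. indicator S (x, y) *
      (increment (cutoff D u) (x, y) * increment (cutoff D v) (x, y) * frac_kernel s (x, y)) \<partial>lebesgue) \<partial>lebesgue)"
  proof (rule Bochner_Integration.integral_cong)
    fix x
    show "indicator D x *\<^sub>R (\<integral>y. (u x - u y) * (v x - v y) / norm (x - y) powr (real CARD('n) + 2 * s)
        \<partial>lebesgue_on (D \<inter> B x)) = (\<integral>y. indicator S (x, y) *
      (increment (cutoff D u) (x, y) * increment (cutoff D v) (x, y) * frac_kernel s (x, y)) \<partial>lebesgue)"
    proof (cases "x \<in> D")
      case True
      then have "(\<integral>y. (u x - u y) * (v x - v y) / norm (x - y) powr (real CARD('n) + 2 * s) \<partial>lebesgue_on (D \<inter> B x))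
        = (\<integral>y. indicator (D \<inter> B x) y *\<^sub>R ((u x - u y) * (v x - v y) / norm (x - y) powr (real CARD('n) + 2 * s)) \<partial>lebesgue)"
        using section_sets by (subst integral_restrict_space) auto
      also have "\<dots> = (\<integral>y. indicator S (x, y) *
          (increment (cutoff D u) (x, y) * increment (cutoff D v) (x, y) * frac_kernel s (x, y)) \<partial>lebesgue)"
        using True by (intro Bochner_Integration.integral_cong)
          (auto simp: S_iff increment_def frac_kernel_def cutoff_def split: split_indicator)
      finally show ?thesis
        using True by simp
    qed (simp add: S_iff)
  qed simp
  also have "\<dots> = (\<integral>z. indicator S z *
      (increment (cutoff D u) z * increment (cutoff D v) z * frac_kernel s z) \<partial>lebesgue_pair)"
    by (rule leb2.integral_fst'[OF int''])
  also have "\<dots> = (\<integral>z. indicator S z * (increment w z * increment w' z * frac_kernel s z) \<partial>lebesgue_pair)"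
    using ae by (intro integral_cong_AE) (measurable, auto elim: eventually_mono)
  finally show ?thesis
    by (simp add: energy_form_def)
qed

end

section \<open>The part of the kernel at distance at least \<delta>\<close>

definition tail_mass :: "(real^'n) set \<Rightarrow> real \<Rightarrow> ennreal" where
  "tail_mass A s = (\<integral>\<^sup>+z. ennreal (indicator A z / norm z powr (real CARD('n) + 2 * s)) \<partial>lborel)"

definition far :: "real \<Rightarrow> (real^'n) set" where
  "far \<delta> = {z. \<delta> \<le> norm z}"

definition tail_kernel :: "real \<Rightarrow> real \<Rightarrow> (real^'n) \<times> (real^'n) \<Rightarrow> real" where
  "tail_kernel s \<delta> z = indicator (far \<delta>) (fst z - snd z) * frac_kernel s z"

lemma far_borel [measurable]: "far \<delta> \<in> sets borel"
  unfolding far_def by measurable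

lemma measurable_tail_kernel [measurable]: "tail_kernel s \<delta> \<in> borel_measurable lebesgue_pair"
  unfolding tail_kernel_def[abs_def] by measurable

lemma tail_kernel_nonneg [simp]: "0 \<le> tail_kernel s \<delta> z"
  by (simp add: tail_kernel_def)

lemma tail_kernel_swap: "tail_kernel s \<delta> (y, x) = tail_kernel s \<delta> (x, y)"
  by (simp add: tail_kernel_def far_def frac_kernel_def norm_minus_commute split: split_indicator)

text \<open>Translation invariance makes the result independent of \<open>x\<close>. This turns the
  energy lost by truncation into a constant multiple of an L2 inner product.\<close>

lemma nn_integral_tail_kernel_section:
  fixes x :: "real^'n"
  shows "(\<integral>\<^sup>+y. ennreal (tail_kernel s \<delta> (x, y)) \<partial>lebesgue) = tail_mass (far \<delta> :: (real^'n) set) s"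
proof -
  define h :: "real^'n \<Rightarrow> ennreal" where
    "h z = ennreal (indicator (far \<delta>) z / norm z powr (real CARD('n) + 2 * s))" for z
  have [measurable]: "h \<in> borel_measurable borel"
    unfolding h_def[abs_def] by measurable
  have "(\<integral>\<^sup>+y. ennreal (tail_kernel s \<delta> (x, y)) \<partial>lebesgue) = (\<integral>\<^sup>+y. h (- x + y) \<partial>lborel)"
    unfolding nn_integral_completion
    by (intro nn_integral_cong)
       (simp add: h_def tail_kernel_def frac_kernel_def far_def norm_minus_commute indicator_def)
  also have "\<dots> = (\<integral>\<^sup>+y. h y \<partial>distr lborel borel ((+) (- x)))"
    by (subst nn_integral_distr) auto
  finally show ?thesis
    by (simp add: lborel_distr_plus tail_mass_def h_def)
qed

text \<open>The kernel exponent exceeds the dimension by \<open>2 * s\<close>, so the tail decays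
  like \<open>\<delta> powr (- (2 * s))\<close>.\<close>

lemma tail_mass_finite_tendsto_0:
  assumes "0 < s"
  shows "\<delta> > 0 \<Longrightarrow> tail_mass (far \<delta> :: (real^'n) set) s < \<infinity>"
    and "((\<lambda>\<delta>. enn2real (tail_mass (far \<delta> :: (real^'n) set) s)) \<longlongrightarrow> 0) at_top"
proof -
  obtain C where C: "C \<ge> 0" "\<And>\<delta>. 0 < \<delta> \<Longrightarrow> tail_mass (far \<delta> :: (real^'n) set) s \<le> ennreal (C * \<delta> powr (- (2 * s)))"
    using kernel_tail_bound[where 'a = "real^'n" and a = "2 * s"] assms
    by (auto simp: tail_mass_def far_def)
  show "tail_mass (far \<delta> :: (real^'n) set) s < \<infinity>" if "\<delta> > 0"
    using C(2)[OF that] by (simp add: le_less_trans)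
  show "((\<lambda>\<delta>. enn2real (tail_mass (far \<delta> :: (real^'n) set) s)) \<longlongrightarrow> 0) at_top"
  proof (rule tendsto_sandwich[where f = "\<lambda>_. 0"])
    show "\<forall>\<^sub>F \<delta> in at_top. enn2real (tail_mass (far \<delta> :: (real^'n) set) s) \<le> C * \<delta> powr (- (2 * s))"
      using eventually_gt_at_top[of 0]
      by eventually_elim (use C in \<open>auto intro!: enn2real_leI\<close>)
    show "((\<lambda>\<delta>. C * \<delta> powr (- (2 * s))) \<longlongrightarrow> 0) at_top"
      using assms by (intro tendsto_mult_right_zero tendsto_neg_powr filterlim_ident) auto
  qed (auto intro: always_eventually)
qed

lemma nn_integral_tail_kernel:
  fixes g :: "real^'n \<Rightarrow> ennreal"
  assumes [measurable]: "g \<in> borel_measurable lebesgue"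
  shows "(\<integral>\<^sup>+z. ennreal (tail_kernel s \<delta> z) * g (fst z) \<partial>lebesgue_pair)
      = tail_mass (far \<delta> :: (real^'n) set) s * (\<integral>\<^sup>+x. g x \<partial>lebesgue)"
    and "(\<integral>\<^sup>+z. ennreal (tail_kernel s \<delta> z) * g (snd z) \<partial>lebesgue_pair)
      = tail_mass (far \<delta> :: (real^'n) set) s * (\<integral>\<^sup>+x. g x \<partial>lebesgue)"
proof -
  have sec: "(\<lambda>y. ennreal (tail_kernel s \<delta> (x, y))) \<in> borel_measurable lebesgue" for x :: "real^'n"
    by measurable
  have "(\<integral>\<^sup>+z. ennreal (tail_kernel s \<delta> z) * g (fst z) \<partial>lebesgue_pair)
      = (\<integral>\<^sup>+x. \<integral>\<^sup>+y. ennreal (tail_kernel s \<delta> (x, y)) * g x \<partial>lebesgue \<partial>lebesgue)"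
    by (subst leb2.M1.nn_integral_fst[symmetric]) simp_all
  then show "(\<integral>\<^sup>+z. ennreal (tail_kernel s \<delta> z) * g (fst z) \<partial>lebesgue_pair)
      = tail_mass (far \<delta> :: (real^'n) set) s * (\<integral>\<^sup>+x. g x \<partial>lebesgue)"
    using sec by (simp add: nn_integral_multc nn_integral_cmult nn_integral_tail_kernel_section)
  have "(\<integral>\<^sup>+z. ennreal (tail_kernel s \<delta> z) * g (snd z) \<partial>lebesgue_pair)
      = (\<integral>\<^sup>+y. \<integral>\<^sup>+x. ennreal (tail_kernel s \<delta> (x, y)) * g y \<partial>lebesgue \<partial>lebesgue)"
    using leb2.nn_integral_snd[of "\<lambda>z. ennreal (tail_kernel s \<delta> z) * g (snd z)"] by simp
  then show "(\<integral>\<^sup>+z. ennreal (tail_kernel s \<delta> z) * g (snd z) \<partial>lebesgue_pair)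
      = tail_mass (far \<delta> :: (real^'n) set) s * (\<integral>\<^sup>+x. g x \<partial>lebesgue)"
    using sec by (simp add: tail_kernel_swap[of s \<delta> _ "_ :: real^'n"] nn_integral_multc nn_integral_cmult nn_integral_tail_kernel_section)
qed

text \<open>The signed version, meant for \<open>f\<close> the product of two square integrable
  functions. Integrability on pairs comes from the nonnegative version applied to the absolute value
  of \<open>f\<close>.\<close>

lemma integral_tail_kernel:
  fixes f :: "real^'n \<Rightarrow> real"
  assumes fin: "tail_mass (far \<delta> :: (real^'n) set) s < \<infinity>" and f: "integrable lebesgue f"
  defines "T \<equiv> enn2real (tail_mass (far \<delta> :: (real^'n) set) s)"
  shows "integrable lebesgue_pair (\<lambda>z. tail_kernel s \<delta> z * f (fst z))"
    and "integrable lebesgue_pair (\<lambda>z. tail_kernel s \<delta> z * f (snd z))"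
    and "(\<integral>z. tail_kernel s \<delta> z * f (fst z) \<partial>lebesgue_pair) = T * (\<integral>x. f x \<partial>lebesgue)"
    and "(\<integral>z. tail_kernel s \<delta> z * f (snd z) \<partial>lebesgue_pair) = T * (\<integral>x. f x \<partial>lebesgue)"
proof -
  have [measurable]: "f \<in> borel_measurable lebesgue"
    using f by auto
  have nf: "(\<integral>\<^sup>+x. ennreal (norm (f x)) \<partial>lebesgue) < \<infinity>"
    using f by (simp add: integrable_iff_bounded)
  show i1: "integrable lebesgue_pair (\<lambda>z. tail_kernel s \<delta> z * f (fst z))"
    and i2: "integrable lebesgue_pair (\<lambda>z. tail_kernel s \<delta> z * f (snd z))"
    using fin nf nn_integral_tail_kernel[of "\<lambda>x. ennreal (norm (f x))" s \<delta>]
    by (auto intro!: integrableI_bounded simp: abs_mult ennreal_mult ennreal_mult_less_top)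
  have T: "(\<integral>y. tail_kernel s \<delta> (x, y) \<partial>lebesgue) = T" for x :: "real^'n"
    unfolding T_def by (subst integral_eq_nn_integral) (auto simp: nn_integral_tail_kernel_section)
  have "(\<integral>z. tail_kernel s \<delta> z * f (fst z) \<partial>lebesgue_pair) = (\<integral>x. \<integral>y. tail_kernel s \<delta> (x, y) * f x \<partial>lebesgue \<partial>lebesgue)"
    using leb2.integral_fst'[OF i1] by simp
  then show "(\<integral>z. tail_kernel s \<delta> z * f (fst z) \<partial>lebesgue_pair) = T * (\<integral>x. f x \<partial>lebesgue)"
    by (simp add: T)
  have "(\<integral>z. tail_kernel s \<delta> z * f (snd z) \<partial>lebesgue_pair) = (\<integral>y. \<integral>x. tail_kernel s \<delta> (x, y) * f y \<partial>lebesgue \<partial>lebesgue)"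
    using leb2.integral_snd[of "\<lambda>x y. tail_kernel s \<delta> (x, y) * f y"] i2 by (simp add: case_prod_unfold)
  also have "\<dots> = (\<integral>y. \<integral>x. tail_kernel s \<delta> (y, x) * f y \<partial>lebesgue \<partial>lebesgue)"
    by (subst tail_kernel_swap) simp
  finally show "(\<integral>z. tail_kernel s \<delta> z * f (snd z) \<partial>lebesgue_pair) = T * (\<integral>x. f x \<partial>lebesgue)"
    by (simp add: T)
qed

subsection \<open>Truncation as a shift of the energy\<close>

lemma sets_lebesgue_open: "open A \<Longrightarrow> A \<in> sets (lebesgue :: (real^'n) measure)"
  by (simp add: borel_open sets_completionI_sets)

lemma abs_mult_le_sum_squares: "\<bar>a * b\<bar> \<le> a\<^sup>2 + (b\<^sup>2 :: real)"
proof -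
  have "2 * (\<bar>a\<bar> * \<bar>b\<bar>) \<le> a\<^sup>2 + b\<^sup>2"
    using sum_squares_bound[of "\<bar>a\<bar>" "\<bar>b\<bar>"] by simp
  moreover have "0 \<le> \<bar>a\<bar> * \<bar>b\<bar>"
    by simp
  ultimately show ?thesis
    unfolding abs_mult by linarith
qed

lemma L2_mult_integrable:
  fixes A :: "(real^'n) set"
  assumes "u \<in> L2 A" "v \<in> L2 A"
  shows "integrable (lebesgue_on A) (\<lambda>x. u x * v x)"
proof (rule Bochner_Integration.integrable_bound)
  show "integrable (lebesgue_on A) (\<lambda>x. (u x)\<^sup>2 + (v x)\<^sup>2)"
    using assms by (simp add: L2_def)
  show "(\<lambda>x. u x * v x) \<in> borel_measurable (lebesgue_on A)"
    using assms by (auto simp: L2_def)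
  show "AE x in lebesgue_on A. norm (u x * v x) \<le> norm ((u x)\<^sup>2 + (v x)\<^sup>2)"
    using abs_mult_le_sum_squares by (intro always_eventually allI) simp
qed

lemma L2_lincomb:
  fixes A :: "(real^'n) set"
  assumes "u \<in> L2 A" "v \<in> L2 A"
  shows "(\<lambda>x. a * u x + b * v x) \<in> L2 A"
proof -
  have "(\<lambda>x. (a * u x + b * v x)\<^sup>2) = (\<lambda>x. a\<^sup>2 * (u x)\<^sup>2 + 2 * a * b * (u x * v x) + b\<^sup>2 * (v x)\<^sup>2)"
    by (simp add: fun_eq_iff power2_eq_square algebra_simps)
  moreover have "integrable (lebesgue_on A) (\<lambda>x. a\<^sup>2 * (u x)\<^sup>2 + 2 * a * b * (u x * v x) + b\<^sup>2 * (v x)\<^sup>2)"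
    using assms L2_mult_integrable[OF assms]
    by (intro Bochner_Integration.integrable_add integrable_mult_right) (simp_all add: L2_def)
  ultimately show ?thesis
    using assms by (auto simp: L2_def)
qed

lemma integrable_L2_cutoff:
  assumes "D \<in> sets lebesgue" "u \<in> borel_measurable (lebesgue_on D)"
  shows "integrable (lebesgue_on D) (\<lambda>x. (u x)\<^sup>2) \<longleftrightarrow> integrable lebesgue (\<lambda>x. (cutoff D u x)\<^sup>2)"
proof -
  have "(\<lambda>x. indicator D x *\<^sub>R (u x)\<^sup>2) = (\<lambda>x. (cutoff D u x)\<^sup>2)"
    by (simp add: fun_eq_iff cutoff_def)
  then show ?thesis
    using assms by (subst integrable_restrict_space) auto
qed

section \<open>The common energy space and the truncated problems expressed on it\<close>

locale dirichlet_domain =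
  fixes \<Omega> :: "(real^'n) set" and s :: real
  assumes open_domain: "open \<Omega>" and s_pos: "0 < s" and s_less_1: "s < 1"
begin

lemma sets_domain [measurable]: "\<Omega> \<in> sets lebesgue"
  by (rule sets_lebesgue_open[OF open_domain])

text \<open>Vanishing is demanded at every point off the domain, not almost everywhere. Each member
  is then its own cutoff and represents a function in the space of every horizon.\<close>

definition core :: "(real^'n \<Rightarrow> real) set" where
  "core = {w \<in> borel_measurable lebesgue. (\<forall>x. x \<notin> \<Omega> \<longrightarrow> w x = 0) \<and>
    integrable lebesgue (\<lambda>x. (w x)\<^sup>2) \<and>
    integrable lebesgue_pair (\<lambda>z. (increment w z)\<^sup>2 * frac_kernel s z)}"

definition core_form :: "(real^'n \<Rightarrow> real) \<Rightarrow> (real^'n \<Rightarrow> real) \<Rightarrow> real" where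
  "core_form u v = frac_const CARD('n) s / 2 *
    (\<integral>z. increment u z * increment v z * frac_kernel s z \<partial>lebesgue_pair)"

lemma frac_const_nonneg: "0 \<le> frac_const CARD('n) s"
  using s_pos s_less_1 by (simp add: frac_const_def)

lemma core_measurable [measurable_dest]: "w \<in> core \<Longrightarrow> w \<in> borel_measurable lebesgue"
  by (simp add: core_def)

lemma core_zero: "w \<in> core \<Longrightarrow> x \<notin> \<Omega> \<Longrightarrow> w x = 0"
  by (simp add: core_def)

lemma integrable_core_increments:
  assumes "u \<in> core" "v \<in> core"
  shows "integrable lebesgue_pair (\<lambda>z. increment u z * increment v z * frac_kernel s z)"
proof (rule Bochner_Integration.integrable_bound)
  note [measurable] = core_measurable[OF assms(1)] core_measurable[OF assms(2)]
  show "integrable lebesgue_pair (\<lambda>z. (increment u z)\<^sup>2 * frac_kernel s z + (increment v z)\<^sup>2 * frac_kernel s z)"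
    using assms by (simp add: core_def)
  show "(\<lambda>z. increment u z * increment v z * frac_kernel s z) \<in> borel_measurable lebesgue_pair"
    by measurable
  have "\<bar>increment u z * increment v z\<bar> * frac_kernel s z
      \<le> ((increment u z)\<^sup>2 + (increment v z)\<^sup>2) * frac_kernel s z" for z
    by (intro mult_right_mono abs_mult_le_sum_squares) auto
  then show "AE z in lebesgue_pair. norm (increment u z * increment v z * frac_kernel s z)
      \<le> norm ((increment u z)\<^sup>2 * frac_kernel s z + (increment v z)\<^sup>2 * frac_kernel s z)"
    by (intro always_eventually allI) (simp add: abs_mult distrib_right)
qed

sublocale L2: semi_inner_product "L2 \<Omega>" "L2_inner \<Omega>"
proof
  show "(\<lambda>x. 0) \<in> L2 \<Omega>"
    by (simp add: L2_def)
  show "L2_inner \<Omega> u v = L2_inner \<Omega> v u" for u v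
    by (simp add: L2_inner_def mult.commute)
  show "L2_inner \<Omega> (\<lambda>x. a * u x + b * v x) w = a * L2_inner \<Omega> u w + b * L2_inner \<Omega> v w"
    if "u \<in> L2 \<Omega>" "v \<in> L2 \<Omega>" "w \<in> L2 \<Omega>" for u v w a b
    using that L2_mult_integrable[of _ \<Omega> w] by (simp add: L2_inner_def distrib_right mult.assoc)
qed (auto simp: L2_lincomb L2_inner_def)

lemma core_lincomb:
  assumes "u \<in> core" "v \<in> core"
  shows "(\<lambda>x. a * u x + b * v x) \<in> core"
proof -
  note [measurable] = core_measurable[OF assms(1)] core_measurable[OF assms(2)]
  have "(\<lambda>z. (increment (\<lambda>x. a * u x + b * v x) z)\<^sup>2 * frac_kernel s z)
      = (\<lambda>z. a\<^sup>2 * ((increment u z)\<^sup>2 * frac_kernel s z)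
        + 2 * a * b * (increment u z * increment v z * frac_kernel s z) + b\<^sup>2 * ((increment v z)\<^sup>2 * frac_kernel s z))"
    by (simp add: fun_eq_iff increment_def power2_eq_square algebra_simps)
  moreover have "integrable lebesgue_pair (\<lambda>z. a\<^sup>2 * ((increment u z)\<^sup>2 * frac_kernel s z)
        + 2 * a * b * (increment u z * increment v z * frac_kernel s z) + b\<^sup>2 * ((increment v z)\<^sup>2 * frac_kernel s z))"
    using assms integrable_core_increments[OF assms]
    by (intro Bochner_Integration.integrable_add integrable_mult_right) (simp_all add: core_def)
  moreover have "integrable lebesgue (\<lambda>x. (a * u x + b * v x)\<^sup>2)"
    using L2_lincomb[of u UNIV v a b] assms by (simp add: L2_def core_def lebesgue_on_UNIV_eq)
  ultimately show ?thesis
    using assms by (auto simp: core_def)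
qed

sublocale core: semi_inner_product core core_form
proof
  show "(\<lambda>x. 0) \<in> core"
    by (simp add: core_def increment_def)
  show "core_form u v = core_form v u" for u v
    by (simp add: core_form_def mult.commute)
  show "core_form (\<lambda>x. a * u x + b * v x) w = a * core_form u w + b * core_form v w"
    if "u \<in> core" "v \<in> core" "w \<in> core" for u v w a b
  proof -
    have "(\<lambda>z. increment (\<lambda>x. a * u x + b * v x) z * increment w z * frac_kernel s z)
      = (\<lambda>z. a * (increment u z * increment w z * frac_kernel s z) + b * (increment v z * increment w z * frac_kernel s z))"
      by (simp add: fun_eq_iff increment_def algebra_simps)
    then show ?thesis
      using that integrable_core_increments[of _ w] by (simp add: core_form_def algebra_simps add_divide_distrib)
  qed
  show "0 \<le> core_form u u" for u
    using frac_const_nonneg by (simp add: core_form_def)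
qed (rule core_lincomb)

lemma core_subset_L2: "core \<subseteq> L2 \<Omega>"
proof
  fix w assume w: "w \<in> core"
  then have "cutoff \<Omega> w = w"
    by (auto simp: cutoff_def core_zero)
  then show "w \<in> L2 \<Omega>"
    using w integrable_L2_cutoff[of \<Omega> w] by (auto simp: L2_def core_def measurable_restrict_space1)
qed

lemma L2_inner_cong: "(\<And>x. x \<in> \<Omega> \<Longrightarrow> u x = u' x) \<Longrightarrow> (\<And>x. x \<in> \<Omega> \<Longrightarrow> v x = v' x) \<Longrightarrow> L2_inner \<Omega> u v = L2_inner \<Omega> u' v'"
  unfolding L2_inner_def by (rule Bochner_Integration.integral_cong) auto

lemma L2_inner_eq_lebesgue: "L2_inner \<Omega> u v = (\<integral>x. cutoff \<Omega> u x * cutoff \<Omega> v x \<partial>lebesgue)"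
  unfolding L2_inner_def
  by (subst integral_restrict_space) (auto simp: cutoff_def intro!: Bochner_Integration.integral_cong split: split_indicator)

lemma cutoff_core [simp]: "w \<in> core \<Longrightarrow> cutoff \<Omega> w = w"
  by (auto simp: cutoff_def core_zero)

text \<open>The whole space realizes the shift 0, and the operator with a horizon \<open>\<delta>\<close> larger than the
  diameter of \<open>\<Omega>\<close> realizes a shift that tends to 0.\<close>

definition realizes :: "(real^'n) set \<Rightarrow> (real^'n \<Rightarrow> (real^'n) set) \<Rightarrow> real \<Rightarrow> bool" where
  "realizes D B \<kappa> \<longleftrightarrow> D \<in> sets lebesgue \<and> \<Omega> \<subseteq> D \<and>
    H0 \<Omega> s D B = {u \<in> borel_measurable (lebesgue_on D).
      (AE x in lebesgue_on D. u x = cutoff \<Omega> u x) \<and> cutoff \<Omega> u \<in> core} \<and>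
    (\<forall>u\<in>H0 \<Omega> s D B. \<forall>v\<in>H0 \<Omega> s D B.
      energy_form s D B u v = core_form (cutoff \<Omega> u) (cutoff \<Omega> v) - \<kappa> * L2_inner \<Omega> u v)"

text \<open>Reduces a realization to two facts about \<open>S\<close>: restricting to
  \<open>S\<close> does not affect finiteness of the seminorm, and it changes the form by the
  multiple \<kappa> of the L2 inner product.\<close>

lemma realizesI:
  assumes reg: "interaction_region D B S" and sub: "\<Omega> \<subseteq> D"
    and fin: "\<And>w. w \<in> borel_measurable lebesgue \<Longrightarrow> (\<And>x. x \<notin> \<Omega> \<Longrightarrow> w x = 0) \<Longrightarrow> integrable lebesgue (\<lambda>x. (w x)\<^sup>2) \<Longrightarrow>
      (\<integral>\<^sup>+z. indicator S z * ennreal ((increment w z)\<^sup>2 * frac_kernel s z) \<partial>lebesgue_pair) < \<infinity> \<longleftrightarrow>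
      integrable lebesgue_pair (\<lambda>z. (increment w z)\<^sup>2 * frac_kernel s z)"
    and form: "\<And>u v. u \<in> core \<Longrightarrow> v \<in> core \<Longrightarrow>
      frac_const CARD('n) s / 2 * (\<integral>z. indicator S z * (increment u z * increment v z * frac_kernel s z) \<partial>lebesgue_pair)
      = core_form u v - \<kappa> * L2_inner \<Omega> u v"
  shows "realizes D B \<kappa>"
proof -
  interpret interaction_region D B S by (rule reg)
  have H0: "u \<in> H0 \<Omega> s D B \<longleftrightarrow> (AE x in lebesgue_on D. u x = cutoff \<Omega> u x) \<and> cutoff \<Omega> u \<in> core"
    if u: "u \<in> borel_measurable (lebesgue_on D)" for u
  proof -
    have cu [measurable]: "cutoff \<Omega> u \<in> borel_measurable lebesgue"
    proof -
      have "cutoff D u \<in> borel_measurable lebesgue"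
        using u by (simp add: measurable_cutoff_iff)
      moreover have "cutoff \<Omega> u = cutoff \<Omega> (cutoff D u)"
        using sub by (auto simp: cutoff_def fun_eq_iff)
      ultimately show ?thesis
        by (metis measurable_cutoff_iff sets_domain measurable_restrict_space1)
    qed
    have [measurable]: "cutoff D u \<in> borel_measurable lebesgue"
      using u by (simp add: measurable_cutoff_iff)
    \<comment> \<open>The Dirichlet condition, rewritten as agreement with a function that lies in
      \<open>core\<close> once it has finite energy.\<close>
    have bc: "(AE x in lebesgue_on (D - \<Omega>). u x = 0) \<longleftrightarrow> (AE x in lebesgue_on D. u x = cutoff \<Omega> u x)"
      by (subst (1 2) AE_restrict_space_iff) (auto simp: cutoff_def intro!: AE_cong)
    show ?thesis
    proof (cases "AE x in lebesgue_on D. u x = cutoff \<Omega> u x")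
      case True
      then have "AE x in lebesgue. x \<in> D \<longrightarrow> u x = cutoff \<Omega> u x"
        by (simp add: AE_restrict_space_iff)
      then have "AE x in lebesgue. (cutoff D u x)\<^sup>2 = (cutoff \<Omega> u x)\<^sup>2"
        by eventually_elim (use sub in \<open>auto simp: cutoff_def\<close>)
      then have "integrable lebesgue (\<lambda>x. (cutoff D u x)\<^sup>2) \<longleftrightarrow> integrable lebesgue (\<lambda>x. (cutoff \<Omega> u x)\<^sup>2)"
        by (intro integrable_cong_AE) measurable
      then have sq: "integrable (lebesgue_on D) (\<lambda>x. (u x)\<^sup>2) \<longleftrightarrow> integrable lebesgue (\<lambda>x. (cutoff \<Omega> u x)\<^sup>2)"
        using integrable_L2_cutoff[OF D u] by simp
      have z: "cutoff \<Omega> u x = 0" if "x \<notin> \<Omega>" for x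
        using that by (simp add: cutoff_def)
      show ?thesis
        using True u cu bc sq z fin[OF cu z] gagliardo_eq_pair[OF cu u True]
        by (auto simp: H0_def L2_def core_def)
    qed (simp add: H0_def bc)
  qed
  have "energy_form s D B u v = core_form (cutoff \<Omega> u) (cutoff \<Omega> v) - \<kappa> * L2_inner \<Omega> u v"
    if u: "u \<in> H0 \<Omega> s D B" and v: "v \<in> H0 \<Omega> s D B" for u v
  proof -
    have um: "u \<in> borel_measurable (lebesgue_on D)" and vm: "v \<in> borel_measurable (lebesgue_on D)"
      using u v by (simp_all add: H0_def L2_def)
    have ua: "AE x in lebesgue_on D. u x = cutoff \<Omega> u x" "cutoff \<Omega> u \<in> core"
      and va: "AE x in lebesgue_on D. v x = cutoff \<Omega> v x" "cutoff \<Omega> v \<in> core"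
      using u v H0[OF um] H0[OF vm] by auto
    have "energy_form s D B u v = core_form (cutoff \<Omega> u) (cutoff \<Omega> v) - \<kappa> * L2_inner \<Omega> (cutoff \<Omega> u) (cutoff \<Omega> v)"
      using energy_form_eq_pair[OF core_measurable core_measurable um ua(1) vm va(1)
          integrable_core_increments, OF ua(2) va(2) ua(2) va(2)] form[OF ua(2) va(2)] by simp
    moreover have "L2_inner \<Omega> (cutoff \<Omega> u) (cutoff \<Omega> v) = L2_inner \<Omega> u v"
      by (rule L2_inner_cong) (auto simp: cutoff_def)
    ultimately show ?thesis
      by simp
  qed
  moreover have "H0 \<Omega> s D B \<subseteq> borel_measurable (lebesgue_on D)"
    by (auto simp: H0_def L2_def)
  ultimately show ?thesis
    unfolding realizes_def using D sub H0 by blast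
qed

lemma nn_integral_increment_finite_iff:
  assumes [measurable]: "w \<in> borel_measurable lebesgue"
  shows "(\<integral>\<^sup>+z. ennreal ((increment w z)\<^sup>2 * frac_kernel s z) \<partial>lebesgue_pair) < \<infinity> \<longleftrightarrow>
      integrable lebesgue_pair (\<lambda>z. (increment w z)\<^sup>2 * frac_kernel s z)"
  by (subst integrable_iff_bounded) simp_all

lemma realizes_UNIV: "realizes UNIV (\<lambda>x. UNIV) 0"
proof (rule realizesI[where S = UNIV])
  show "interaction_region UNIV (\<lambda>x. UNIV) (UNIV :: ((real^'n) \<times> (real^'n)) set)"
    using sets.top[of "lebesgue_pair :: ((real^'n) \<times> (real^'n)) measure"]
    by unfold_locales (simp_all add: space_pair_measure)
  show "(\<integral>\<^sup>+z. indicator UNIV z * ennreal ((increment w z)\<^sup>2 * frac_kernel s z) \<partial>lebesgue_pair) < \<infinity> \<longleftrightarrow>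
      integrable lebesgue_pair (\<lambda>z. (increment w z)\<^sup>2 * frac_kernel s z)"
    if "w \<in> borel_measurable lebesgue" for w
    using nn_integral_increment_finite_iff[OF that] by simp
qed (simp_all add: core_form_def)

lemma interaction_region_enlarged:
  assumes "open D"
  shows "interaction_region D (\<lambda>x. ball x \<delta>) {z. fst z \<in> D \<and> snd z \<in> D \<and> norm (fst z - snd z) < \<delta>}"
proof
  have [measurable]: "D \<in> sets borel"
    using assms by simp
  have "{z \<in> space lebesgue_pair. fst z \<in> D \<and> snd z \<in> D \<and> norm (fst z - snd z) < \<delta>} \<in> sets lebesgue_pair"
    by measurable
  then show "{z. fst z \<in> D \<and> snd z \<in> D \<and> norm (fst z - snd z) < \<delta>} \<in> sets lebesgue_pair"
    by (simp add: space_pair_measure)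
qed (use assms in \<open>auto simp: sets_lebesgue_open dist_norm\<close>)

text \<open>As a union of open balls the enlarged set is open, which settles all its measurability
  questions.\<close>

lemma enlarged_eq: "0 < \<delta> \<Longrightarrow> enlarged \<Omega> \<delta> = (\<Union>x\<in>\<Omega>. ball x \<delta>)"
  by (force simp: enlarged_def nonlocal_boundary_def dist_norm)

text \<open>The first and the second variable each contribute the tail mass times the L2 inner
  product. The factor 1/2 in the energy absorbs this doubling, hence the shift is
  \<open>frac_const\<close> times the tail mass.\<close>

lemma realizes_enlarged:
  assumes \<delta>: "0 < \<delta>" and diam: "\<And>x y. x \<in> \<Omega> \<Longrightarrow> y \<in> \<Omega> \<Longrightarrow> norm (x - y) < \<delta>"
  shows "realizes (enlarged \<Omega> \<delta>) (\<lambda>x. ball x \<delta>)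
    (frac_const CARD('n) s * enn2real (tail_mass (far \<delta> :: (real^'n) set) s))"
proof -
  define D where "D = enlarged \<Omega> \<delta>"
  define S where "S = {z. fst z \<in> D \<and> snd z \<in> D \<and> norm (fst z - snd z) < \<delta>}"
  define T where "T = enn2real (tail_mass (far \<delta> :: (real^'n) set) s)"
  have fin: "tail_mass (far \<delta> :: (real^'n) set) s < \<infinity>"
    using tail_mass_finite_tendsto_0(1)[OF s_pos \<delta>] .
  have "open D" and sub: "\<Omega> \<subseteq> D"
    using \<delta> by (auto simp: D_def enlarged_eq)
  then have reg: "interaction_region D (\<lambda>x. ball x \<delta>) S"
    unfolding S_def by (intro interaction_region_enlarged)
  then have [measurable]: "S \<in> sets lebesgue_pair"
    by (rule interaction_region.S)
  have D: "y \<in> D" if "x \<in> \<Omega>" "norm (x - y) < \<delta>" for x y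
    using that \<delta> by (auto simp: D_def enlarged_eq dist_norm)
  \<comment> \<open>A pair at distance at least \<open>\<delta>\<close> has at most one point in \<open>\<Omega>\<close>, so the mixed terms of
    the product of increments vanish there.\<close>
  have split: "increment u z * increment v z * frac_kernel s z = indicator S z * (increment u z * increment v z * frac_kernel s z)
      + (tail_kernel s \<delta> z * (u (fst z) * v (fst z)) + tail_kernel s \<delta> z * (u (snd z) * v (snd z)))"
    if u: "\<And>x. x \<notin> \<Omega> \<Longrightarrow> u x = 0" and v: "\<And>x. x \<notin> \<Omega> \<Longrightarrow> v x = 0" for u v z
  proof (cases "norm (fst z - snd z) < \<delta>")
    case True
    \<comment> \<open>A pair at distance below \<delta> with one point in the domain has both points
      in \<open>D\<close>. With neither point in the domain its increment is zero, so near pairs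
      outside \<open>S\<close> contribute nothing.\<close>
    then have "z \<in> S" if "fst z \<in> \<Omega> \<or> snd z \<in> \<Omega>"
      using that D sub by (auto simp: S_def norm_minus_commute)
    then have "z \<in> S \<or> increment u z = 0"
      using u by (cases "fst z \<in> \<Omega> \<or> snd z \<in> \<Omega>") (auto simp: increment_def)
    then show ?thesis
      using True by (auto simp: tail_kernel_def far_def split: split_indicator)
  next
    case False
    then have "fst z \<notin> \<Omega> \<or> snd z \<notin> \<Omega>"
      using diam by blast
    then have "increment u z * increment v z = u (fst z) * v (fst z) + u (snd z) * v (snd z)"
      using u v by (auto simp: increment_def)
    then show ?thesis
      using False by (simp add: S_def tail_kernel_def far_def algebra_simps)
  qed
  have "realizes D (\<lambda>x. ball x \<delta>) (frac_const CARD('n) s * T)"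
  proof (rule realizesI[OF reg sub])
    fix w :: "real^'n \<Rightarrow> real"
    assume [measurable]: "w \<in> borel_measurable lebesgue" and w: "\<And>x. x \<notin> \<Omega> \<Longrightarrow> w x = 0"
      and sq: "integrable lebesgue (\<lambda>x. (w x)\<^sup>2)"
    let ?g = "\<lambda>z. (increment w z)\<^sup>2 * frac_kernel s z"
    let ?t = "\<lambda>z. tail_kernel s \<delta> z * (w (fst z))\<^sup>2 + tail_kernel s \<delta> z * (w (snd z))\<^sup>2"
    have t: "integrable lebesgue_pair ?t"
      using integral_tail_kernel(1,2)[OF fin sq] by simp
    \<comment> \<open>The integrand off \<open>S\<close> equals the integrable tail term, so it
      cannot influence finiteness.\<close>
    have g: "?g z = indicator S z * ?g z + ?t z" for z
      using split[of w w z, OF w w] by (simp add: power2_eq_square)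
    have eq: "(\<lambda>z. indicator S z * ennreal (?g z)) = (\<lambda>z. ennreal (norm (indicator S z * ?g z)))"
      by (auto simp: fun_eq_iff split: split_indicator)
    have "(\<integral>\<^sup>+z. indicator S z * ennreal (?g z) \<partial>lebesgue_pair) < \<infinity> \<longleftrightarrow> integrable lebesgue_pair (\<lambda>z. indicator S z * ?g z)"
      unfolding eq by (subst integrable_iff_bounded) simp
    also have "\<dots> \<longleftrightarrow> integrable lebesgue_pair ?g"
    proof
      assume "integrable lebesgue_pair (\<lambda>z. indicator S z * ?g z)"
      from Bochner_Integration.integrable_add[OF this t] show "integrable lebesgue_pair ?g"
        by (simp flip: g)
    next
      assume "integrable lebesgue_pair ?g"
      from integrable_mult_indicator[OF _ this] show "integrable lebesgue_pair (\<lambda>z. indicator S z * ?g z)"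
        by simp
    qed
    finally show "(\<integral>\<^sup>+z. indicator S z * ennreal (?g z) \<partial>lebesgue_pair) < \<infinity> \<longleftrightarrow> integrable lebesgue_pair ?g" .
  next
    fix u v assume uv: "u \<in> core" "v \<in> core"
    let ?g = "\<lambda>z. increment u z * increment v z * frac_kernel s z"
    let ?t = "\<lambda>z. tail_kernel s \<delta> z * (u (fst z) * v (fst z)) + tail_kernel s \<delta> z * (u (snd z) * v (snd z))"
    have int: "integrable lebesgue (\<lambda>x. u x * v x)"
      using L2_mult_integrable[of u UNIV v] uv by (simp add: L2_def core_def lebesgue_on_UNIV_eq)
    have t: "integrable lebesgue_pair ?t"
      using integral_tail_kernel(1,2)[OF fin int] by simp
    have It: "(\<integral>z. ?t z \<partial>lebesgue_pair) = 2 * T * L2_inner \<Omega> u v"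
      using integral_tail_kernel[OF fin int] uv by (simp add: T_def L2_inner_eq_lebesgue)
    have gS: "integrable lebesgue_pair (\<lambda>z. indicator S z * ?g z)"
      using integrable_mult_indicator[OF _ integrable_core_increments[OF uv], of S] by simp
    have "(\<integral>z. ?g z \<partial>lebesgue_pair) = (\<integral>z. indicator S z * ?g z + ?t z \<partial>lebesgue_pair)"
      using split[of u v] core_zero[OF uv(1)] core_zero[OF uv(2)]
      by (intro Bochner_Integration.integral_cong) blast+
    also have "\<dots> = (\<integral>z. indicator S z * ?g z \<partial>lebesgue_pair) + 2 * T * L2_inner \<Omega> u v"
      using gS t It by (subst Bochner_Integration.integral_add) auto
    finally show "frac_const CARD('n) s / 2 * (\<integral>z. indicator S z * ?g z \<partial>lebesgue_pair)
        = core_form u v - frac_const CARD('n) s * T * L2_inner \<Omega> u v"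
      by (simp add: core_form_def algebra_simps)
  qed
  then show ?thesis
    by (simp add: D_def T_def)
qed

end

subsection \<open>Transfer of eigenspaces and bases\<close>

context dirichlet_domain
begin

definition core_eigenspace :: "real \<Rightarrow> (real^'n \<Rightarrow> real) set" where
  "core_eigenspace \<mu> = {w \<in> core. \<forall>v\<in>core. core_form w v = \<mu> * L2_inner \<Omega> w v}"

context
  fixes D :: "(real^'n) set" and B :: "real^'n \<Rightarrow> (real^'n) set" and \<kappa> :: real
  assumes realizes: "realizes D B \<kappa>"
begin

lemma sets_D: "D \<in> sets lebesgue" and domain_subset: "\<Omega> \<subseteq> D"
  using realizes by (simp_all add: realizes_def)

lemma H0_iff: "u \<in> H0 \<Omega> s D B \<longleftrightarrow> u \<in> borel_measurable (lebesgue_on D) \<and>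
    (AE x in lebesgue_on D. u x = cutoff \<Omega> u x) \<and> cutoff \<Omega> u \<in> core"
  using realizes by (simp add: realizes_def)

lemma energy_form_eq: "u \<in> H0 \<Omega> s D B \<Longrightarrow> v \<in> H0 \<Omega> s D B \<Longrightarrow>
    energy_form s D B u v = core_form (cutoff \<Omega> u) (cutoff \<Omega> v) - \<kappa> * L2_inner \<Omega> u v"
  using realizes by (simp add: realizes_def)

lemma core_subset_H0: "core \<subseteq> H0 \<Omega> s D B"
  by (auto simp: H0_iff core_measurable measurable_restrict_space1)

lemma L2_inner_cutoff: "L2_inner \<Omega> (cutoff \<Omega> u) (cutoff \<Omega> v) = L2_inner \<Omega> u v"
  by (rule L2_inner_cong) (auto simp: cutoff_def)

lemma AE_enlarge:
  assumes "\<And>x. x \<notin> \<Omega> \<Longrightarrow> P x"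
  shows "(AE x in lebesgue_on D. P x) \<longleftrightarrow> (AE x in lebesgue. P x)"
proof -
  have "(x \<in> D \<longrightarrow> P x) \<longleftrightarrow> P x" for x
    using assms domain_subset by blast
  then show ?thesis
    using sets_D by (simp add: AE_restrict_space_iff)
qed

lemma AE_zero_iff:
  assumes "u \<in> H0 \<Omega> s D B"
  shows "(AE x in lebesgue_on D. u x = 0) \<longleftrightarrow> (AE x in lebesgue. cutoff \<Omega> u x = 0)"
proof -
  have "AE x in lebesgue_on D. u x = cutoff \<Omega> u x"
    using assms by (simp add: H0_iff)
  then have "(AE x in lebesgue_on D. u x = 0) \<longleftrightarrow> (AE x in lebesgue_on D. cutoff \<Omega> u x = 0)"
    by (intro iffI) (erule (1) eventually_elim2, simp)+
  also have "\<dots> \<longleftrightarrow> (AE x in lebesgue. cutoff \<Omega> u x = 0)"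
    by (rule AE_enlarge) (simp add: cutoff_def)
  finally show ?thesis .
qed

text \<open>Membership goes through \<open>core\<close>, where closure under finite combinations is
  known; cutoff commutes with them.\<close>

lemma H0_residual:
  fixes \<phi> :: "nat \<Rightarrow> real^'n \<Rightarrow> real"
  assumes v: "v \<in> H0 \<Omega> s D B" and \<phi>: "\<And>i. \<phi> i \<in> H0 \<Omega> s D B"
  shows "(\<lambda>x. v x - (\<Sum>i<n. c i * \<phi> i x)) \<in> H0 \<Omega> s D B"
    and "cutoff \<Omega> (\<lambda>x. v x - (\<Sum>i<n. c i * \<phi> i x)) = (\<lambda>x. cutoff \<Omega> v x - (\<Sum>i<n. c i * cutoff \<Omega> (\<phi> i) x))"
proof -
  show eq: "cutoff \<Omega> (\<lambda>x. v x - (\<Sum>i<n. c i * \<phi> i x)) = (\<lambda>x. cutoff \<Omega> v x - (\<Sum>i<n. c i * cutoff \<Omega> (\<phi> i) x))"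
    by (auto simp: cutoff_def fun_eq_iff)
  have meas [measurable]: "v \<in> borel_measurable (lebesgue_on D)" "\<phi> i \<in> borel_measurable (lebesgue_on D)" for i
    using v \<phi> by (simp_all add: H0_iff)
  have "AE x in lebesgue_on D. \<forall>i. \<phi> i x = cutoff \<Omega> (\<phi> i) x"
    using \<phi> by (subst AE_all_countable) (simp add: H0_iff)
  moreover have "AE x in lebesgue_on D. v x = cutoff \<Omega> v x"
    using v by (simp add: H0_iff)
  ultimately have "AE x in lebesgue_on D. v x - (\<Sum>i<n. c i * \<phi> i x)
      = cutoff \<Omega> (\<lambda>x. v x - (\<Sum>i<n. c i * \<phi> i x)) x"
    by eventually_elim (simp add: eq)
  moreover have "cutoff \<Omega> (\<lambda>x. v x - (\<Sum>i<n. c i * \<phi> i x)) \<in> core"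
    unfolding eq using v \<phi> by (intro core.diff_closed core.sum_closed) (simp_all add: H0_iff)
  moreover have "(\<lambda>x. v x - (\<Sum>i<n. c i * \<phi> i x)) \<in> borel_measurable (lebesgue_on D)"
    by measurable
  ultimately show "(\<lambda>x. v x - (\<Sum>i<n. c i * \<phi> i x)) \<in> H0 \<Omega> s D B"
    by (simp add: H0_iff)
qed

text \<open>Lowering the form by \<kappa> times the L2 inner product lowers each eigenvalue by
  \<kappa> and keeps its eigenfunctions. The two families of test functions match: members of
  \<open>core\<close> are admissible, and cutoffs of admissible functions lie in
  \<open>core\<close>.\<close>

lemma eigenspace_iff: "u \<in> eigenspace \<Omega> s D B \<mu> \<longleftrightarrow>
    u \<in> H0 \<Omega> s D B \<and> cutoff \<Omega> u \<in> core_eigenspace (\<mu> + \<kappa>)"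
proof (cases "u \<in> H0 \<Omega> s D B")
  case u: True
  have "(\<forall>v\<in>H0 \<Omega> s D B. energy_form s D B u v = \<mu> * L2_inner \<Omega> u v) \<longleftrightarrow>
    (\<forall>w\<in>core. core_form (cutoff \<Omega> u) w = (\<mu> + \<kappa>) * L2_inner \<Omega> (cutoff \<Omega> u) w)" (is "?l \<longleftrightarrow> ?r")
  proof
    assume l: ?l
    show ?r
    proof
      fix w assume w: "w \<in> core"
      then have "w \<in> H0 \<Omega> s D B"
        using core_subset_H0 by blast
      then have "core_form (cutoff \<Omega> u) w - \<kappa> * L2_inner \<Omega> u w = \<mu> * L2_inner \<Omega> u w"
        using l energy_form_eq[OF u, of w] w by simp
      then show "core_form (cutoff \<Omega> u) w = (\<mu> + \<kappa>) * L2_inner \<Omega> (cutoff \<Omega> u) w"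
        using L2_inner_cutoff[of u w] w by (simp add: distrib_right)
    qed
  next
    assume r: ?r
    show ?l
    proof
      fix v assume v: "v \<in> H0 \<Omega> s D B"
      then have "cutoff \<Omega> v \<in> core"
        by (simp add: H0_iff)
      then have "core_form (cutoff \<Omega> u) (cutoff \<Omega> v) = (\<mu> + \<kappa>) * L2_inner \<Omega> u v"
        using r by (simp add: L2_inner_cutoff)
      then show "energy_form s D B u v = \<mu> * L2_inner \<Omega> u v"
        by (simp add: energy_form_eq[OF u v] distrib_right)
    qed
  qed
  then show ?thesis
    using u by (simp add: eigenspace_def core_eigenspace_def H0_iff)
qed (simp add: eigenspace_def)

lemma core_eigenspace_subset: "core_eigenspace (\<mu> + \<kappa>) \<subseteq> eigenspace \<Omega> s D B \<mu>"
  using core_subset_H0 by (auto simp: eigenspace_iff core_eigenspace_def)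

lemma is_eigenvalue_iff:
  "is_eigenvalue \<Omega> s D B \<mu> \<longleftrightarrow> (\<exists>w\<in>core_eigenspace (\<mu> + \<kappa>). \<not> (AE x in lebesgue. w x = 0))"
proof
  assume "is_eigenvalue \<Omega> s D B \<mu>"
  then show "\<exists>w\<in>core_eigenspace (\<mu> + \<kappa>). \<not> (AE x in lebesgue. w x = 0)"
    using AE_zero_iff by (force simp: is_eigenvalue_def is_eigenfunction_def eigenspace_iff)
next
  assume "\<exists>w\<in>core_eigenspace (\<mu> + \<kappa>). \<not> (AE x in lebesgue. w x = 0)"
  then obtain w where w: "w \<in> core_eigenspace (\<mu> + \<kappa>)" "\<not> (AE x in lebesgue. w x = 0)"
    by blast
  then have "w \<in> H0 \<Omega> s D B" "cutoff \<Omega> w = w"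
    using core_subset_H0 by (auto simp: core_eigenspace_def)
  then show "is_eigenvalue \<Omega> s D B \<mu>"
    using w core_eigenspace_subset[of \<mu>] AE_zero_iff[of w]
    by (auto simp: is_eigenvalue_def is_eigenfunction_def)
qed

text \<open>The two sides use different measures and different spaces, matched by cutoff. Since
  \<open>ae_dim\<close> is a definite description over \<open>n\<close>, equivalence for every
  \<open>n\<close> makes the two dimensions equal.\<close>

lemma ae_basis_iff:
  "(\<exists>e. ae_basis (lebesgue_on D) (eigenspace \<Omega> s D B \<mu>) n e) \<longleftrightarrow>
   (\<exists>e. ae_basis lebesgue (core_eigenspace (\<mu> + \<kappa>)) n e)"
proof
  assume "\<exists>e. ae_basis (lebesgue_on D) (eigenspace \<Omega> s D B \<mu>) n e"
  then obtain e where e: "\<forall>i<n. e i \<in> eigenspace \<Omega> s D B \<mu>"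
    and indep: "\<And>c. (AE x in lebesgue_on D. (\<Sum>i<n. c i * e i x) = 0) \<Longrightarrow> \<forall>i<n. c i = 0"
    and span: "\<And>v. v \<in> eigenspace \<Omega> s D B \<mu> \<Longrightarrow> \<exists>c. AE x in lebesgue_on D. v x = (\<Sum>i<n. c i * e i x)"
    unfolding ae_basis_def by blast
  have "AE x in lebesgue_on D. \<forall>i\<in>{..<n}. e i x = cutoff \<Omega> (e i) x"
    using e by (subst AE_finite_all) (simp_all add: eigenspace_iff H0_iff)
  \<comment> \<open>The quantifier over \<open>c\<close> stands inside: a single null set serves all
    coefficient choices.\<close>
  then have sum: "AE x in lebesgue_on D. \<forall>c. (\<Sum>i<n. c i * e i x) = (\<Sum>i<n. c i * cutoff \<Omega> (e i) x)"
    by eventually_elim simp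
  have "ae_basis lebesgue (core_eigenspace (\<mu> + \<kappa>)) n (\<lambda>i. cutoff \<Omega> (e i))"
    unfolding ae_basis_def
  proof (intro conjI allI impI ballI)
    show "cutoff \<Omega> (e i) \<in> core_eigenspace (\<mu> + \<kappa>)" if "i < n" for i
      using e that by (simp add: eigenspace_iff)
  next
    fix c i assume "AE x in lebesgue. (\<Sum>i<n. c i * cutoff \<Omega> (e i) x) = 0" "i < n"
    then have "AE x in lebesgue_on D. (\<Sum>i<n. c i * cutoff \<Omega> (e i) x) = 0"
      by (subst AE_enlarge) (simp_all add: cutoff_def)
    with sum have "AE x in lebesgue_on D. (\<Sum>i<n. c i * e i x) = 0"
      by eventually_elim simp
    then show "c i = 0"
      using indep \<open>i < n\<close> by blast
  next
    fix v assume v: "v \<in> core_eigenspace (\<mu> + \<kappa>)"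
    then obtain c where "AE x in lebesgue_on D. v x = (\<Sum>i<n. c i * e i x)"
      using span core_eigenspace_subset by blast
    with sum have "AE x in lebesgue_on D. v x = (\<Sum>i<n. c i * cutoff \<Omega> (e i) x)"
      by eventually_elim simp
    then show "\<exists>c. AE x in lebesgue. v x = (\<Sum>i<n. c i * cutoff \<Omega> (e i) x)"
      using v by (subst (asm) AE_enlarge) (auto simp: cutoff_def core_eigenspace_def core_zero)
  qed
  then show "\<exists>e. ae_basis lebesgue (core_eigenspace (\<mu> + \<kappa>)) n e"
    by blast
next
  assume "\<exists>e. ae_basis lebesgue (core_eigenspace (\<mu> + \<kappa>)) n e"
  then obtain e where e: "\<And>i. i < n \<Longrightarrow> e i \<in> core_eigenspace (\<mu> + \<kappa>)"
    and indep: "\<And>c. (AE x in lebesgue. (\<Sum>i<n. c i * e i x) = 0) \<Longrightarrow> \<forall>i<n. c i = 0"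
    and span: "\<And>v. v \<in> core_eigenspace (\<mu> + \<kappa>) \<Longrightarrow> \<exists>c. AE x in lebesgue. v x = (\<Sum>i<n. c i * e i x)"
    unfolding ae_basis_def by blast
  have zero: "e i x = 0" if "i < n" "x \<notin> \<Omega>" for i x
    using e[of i] that by (simp add: core_eigenspace_def core_zero)
  have "ae_basis (lebesgue_on D) (eigenspace \<Omega> s D B \<mu>) n e"
    unfolding ae_basis_def
  proof (intro conjI allI impI ballI)
    show "e i \<in> eigenspace \<Omega> s D B \<mu>" if "i < n" for i
      using e[OF that] core_eigenspace_subset by blast
  next
    fix c i assume "AE x in lebesgue_on D. (\<Sum>i<n. c i * e i x) = 0" "i < n"
    then show "c i = 0"
      using indep[of c] by (subst (asm) AE_enlarge) (simp_all add: zero)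
  next
    fix v assume v: "v \<in> eigenspace \<Omega> s D B \<mu>"
    then obtain c where "AE x in lebesgue. cutoff \<Omega> v x = (\<Sum>i<n. c i * e i x)"
      using span[of "cutoff \<Omega> v"] by (auto simp: eigenspace_iff)
    then have "AE x in lebesgue_on D. cutoff \<Omega> v x = (\<Sum>i<n. c i * e i x)"
      by (subst AE_enlarge) (simp_all add: zero cutoff_def)
    moreover have "AE x in lebesgue_on D. v x = cutoff \<Omega> v x"
      using v by (simp add: eigenspace_iff H0_iff)
    ultimately have "AE x in lebesgue_on D. v x = (\<Sum>i<n. c i * e i x)"
      by eventually_elim simp
    then show "\<exists>c. AE x in lebesgue_on D. v x = (\<Sum>i<n. c i * e i x)"
      by blast
  qed
  then show "\<exists>e. ae_basis (lebesgue_on D) (eigenspace \<Omega> s D B \<mu>) n e"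
    by blast
qed

lemma eigen_multiplicity_eq:
  "eigen_multiplicity \<Omega> s D B \<mu> = ae_dim lebesgue (core_eigenspace (\<mu> + \<kappa>))"
  by (simp add: eigen_multiplicity_def ae_dim_def ae_basis_iff)

text \<open>The range and the level counts are expressed through \<open>core_eigenspace\<close>
  alone, so they coincide for any two realizations. The \<open>else 0\<close> branch makes the count
  valid for every \<open>y\<close>.\<close>

lemma eigenvalue_listing_shifted:
  assumes "eigenvalue_listing \<Omega> s D B lam"
  shows "mono (\<lambda>k. lam k + \<kappa>)" "filterlim (\<lambda>k. lam k + \<kappa>) at_top sequentially"
    and "range (\<lambda>k. lam k + \<kappa>) = {\<nu>. \<exists>w\<in>core_eigenspace \<nu>. \<not> (AE x in lebesgue. w x = 0)}"
    and "card {j. lam j + \<kappa> = y} =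
      (if y \<in> range (\<lambda>k. lam k + \<kappa>) then ae_dim lebesgue (core_eigenspace y) else 0)"
proof -
  show "mono (\<lambda>k. lam k + \<kappa>)"
    using assms by (simp add: eigenvalue_listing_def mono_def)
  show "filterlim (\<lambda>k. lam k + \<kappa>) at_top sequentially"
    using assms filterlim_tendsto_add_at_top[OF tendsto_const, of lam sequentially \<kappa>]
    by (simp add: eigenvalue_listing_def add.commute)
  have "range (\<lambda>k. lam k + \<kappa>) = (\<lambda>\<mu>. \<mu> + \<kappa>) ` {\<mu>. is_eigenvalue \<Omega> s D B \<mu>}"
    using assms image_image[of "\<lambda>\<mu>. \<mu> + \<kappa>" lam UNIV] by (simp add: eigenvalue_listing_def)
  also have "\<dots> = {\<nu>. \<exists>w\<in>core_eigenspace \<nu>. \<not> (AE x in lebesgue. w x = 0)}"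
    unfolding is_eigenvalue_iff by (force intro: image_eqI[of _ _ "_ - \<kappa>"])
  finally show "range (\<lambda>k. lam k + \<kappa>) = {\<nu>. \<exists>w\<in>core_eigenspace \<nu>. \<not> (AE x in lebesgue. w x = 0)}" .
  show "card {j. lam j + \<kappa> = y} =
      (if y \<in> range (\<lambda>k. lam k + \<kappa>) then ae_dim lebesgue (core_eigenspace y) else 0)"
  proof (cases "y \<in> range (\<lambda>k. lam k + \<kappa>)")
    case True
    then obtain k where k: "y = lam k + \<kappa>"
      by blast
    have "card {j. lam j = lam k} = eigen_multiplicity \<Omega> s D B (lam k)"
      using assms by (simp add: eigenvalue_listing_def)
    then show ?thesis
      using k by (simp add: eigen_multiplicity_eq)
  next
    case False
    then have "{j. lam j + \<kappa> = y} = {}"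
      by auto
    then show ?thesis
      using False by (simp only: card.empty if_False)
  qed
qed

end

lemma eigenvalue_listings_eq:
  assumes "realizes D B \<kappa>" "eigenvalue_listing \<Omega> s D B lam"
    and "realizes D' B' \<kappa>'" "eigenvalue_listing \<Omega> s D' B' lam'"
  shows "lam k + \<kappa> = lam' k + \<kappa>'"
proof -
  note l = eigenvalue_listing_shifted[OF assms(1,2)] and l' = eigenvalue_listing_shifted[OF assms(3,4)]
  have r: "range (\<lambda>k. lam k + \<kappa>) = range (\<lambda>k. lam' k + \<kappa>')"
    unfolding l(3) l'(3) ..
  have "card {j. lam j + \<kappa> = y} = card {j. lam' j + \<kappa>' = y}" for y
    unfolding l(4) l'(4) r ..
  with mono_eq_if_level_cards_eq[OF l(1,2) l'(1,2) r] show ?thesis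
    by (simp add: fun_eq_iff)
qed

text \<open>The notion of eigenfunction basis that does not mention \<open>(D, B)\<close>.
  Orthogonality in energy is a consequence of the eigenvalue equation and orthonormality in
  L2.\<close>

definition core_basis :: "(nat \<Rightarrow> real) \<Rightarrow> (nat \<Rightarrow> real^'n \<Rightarrow> real) \<Rightarrow> bool" where
  "core_basis lam e \<longleftrightarrow> (\<forall>k. e k \<in> core_eigenspace (lam k)) \<and>
    orthonormal_basis (L2 \<Omega>) (L2_inner \<Omega>) e \<and>
    (\<forall>v\<in>core. \<forall>\<epsilon>>0. \<exists>n c.
      core_form (\<lambda>x. v x - (\<Sum>i<n. c i * e i x)) (\<lambda>x. v x - (\<Sum>i<n. c i * e i x)) < \<epsilon>) \<and>
    (AE x in lebesgue_on \<Omega>. 0 \<le> e 0 x)"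

text \<open>For an eigenfunction basis the Fourier coefficients in \<open>L2\<close> and in the energy agree, so the
  same partial sums converge in both norms. This absorbs the shift of the energy.\<close>

lemma core_basis_cutoff:
  assumes R: "realizes D B \<kappa>" and basis: "eigenfunction_basis \<Omega> s D B lam \<phi>" and pos: "\<And>k. 0 < lam k"
  shows "core_basis (\<lambda>k. lam k + \<kappa>) (\<lambda>k. cutoff \<Omega> (\<phi> k))"
proof -
  define e where "e k = cutoff \<Omega> (\<phi> k)" for k
  define F where "F u v = core_form u v - \<kappa> * L2_inner \<Omega> u v" for u v
  have \<phi>: "\<phi> k \<in> H0 \<Omega> s D B" and e: "e k \<in> core_eigenspace (lam k + \<kappa>)" for k
    using basis by (auto simp: eigenfunction_basis_def is_eigenfunction_def eigenspace_iff[OF R] e_def)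
  then have e_core: "e k \<in> core" for k
    by (simp add: core_eigenspace_def)
  then have e_L2: "e k \<in> L2 \<Omega>" for k
    using core_subset_L2 by blast
  have same: "L2_inner \<Omega> u v = L2_inner \<Omega> u' v'"
    if "cutoff \<Omega> u = cutoff \<Omega> u'" "cutoff \<Omega> v = cutoff \<Omega> v'" for u v u' v'
    using that by (simp add: L2_inner_eq_lebesgue)
  have res: "cutoff \<Omega> (\<lambda>x. v x - (\<Sum>i<n. c i * \<phi> i x)) = cutoff \<Omega> (\<lambda>x. v x - (\<Sum>i<n. c i * e i x))" for v n c
    by (auto simp: fun_eq_iff cutoff_def e_def)
  have "orthonormal_basis (L2 \<Omega>) (L2_inner \<Omega>) \<phi>"
    using basis by (simp add: eigenfunction_basis_def)
  then have L2: "orthonormal_basis (L2 \<Omega>) (L2_inner \<Omega>) e"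
    using e_L2 L2_inner_cutoff[OF R]
    by (simp add: orthonormal_basis_def orthogonal_basis_def same[OF res res] e_def)
  then have one: "L2_inner \<Omega> (e i) (e i) = 1" and orth: "i \<noteq> j \<Longrightarrow> L2_inner \<Omega> (e i) (e j) = 0" for i j
    by (auto simp: orthonormal_basis_def orthogonal_basis_def)
  have F_energy: "F u v = energy_form s D B u v" if "u \<in> core" "v \<in> core" for u v
    using energy_form_eq[OF R, of u v] core_subset_H0[OF R] that by (simp add: F_def subset_iff)
  interpret F: semi_inner_product core F
  proof
    show "F u v = F v u" if "u \<in> core" "v \<in> core" for u v
      using that core_subset_L2 by (simp add: F_def core.ip_sym L2.ip_sym subset_iff)
    show "F (\<lambda>x. a * u x + b * v x) w = a * F u w + b * F v w"
      if "u \<in> core" "v \<in> core" "w \<in> core" for u v w a b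
    proof -
      have "u \<in> L2 \<Omega>" "v \<in> L2 \<Omega>" "w \<in> L2 \<Omega>"
        using that core_subset_L2 by auto
      then show ?thesis
        using that by (simp add: F_def core.ip_lincomb L2.ip_lincomb algebra_simps)
    qed
    \<comment> \<open>The sign is not visible in the difference defining \<open>F\<close>; it is
      read off from the square in the truncated energy that \<open>F\<close> represents.\<close>
    show "0 \<le> F u u" if "u \<in> core" for u
      unfolding F_energy[OF that that] energy_form_def using frac_const_nonneg
      by (intro mult_nonneg_nonneg integral_nonneg_AE always_eventually allI) auto
  qed (auto intro: core.zero_closed core_lincomb)
  have Fe: "F (e i) v = lam i * L2_inner \<Omega> (e i) v" if "v \<in> core" for i v
    using e[of i] that by (simp add: F_def core_eigenspace_def algebra_simps)
  have dense: "\<exists>n c. core_form (\<lambda>x. v x - (\<Sum>i<n. c i * e i x)) (\<lambda>x. v x - (\<Sum>i<n. c i * e i x)) < \<epsilon>"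
    if v: "v \<in> core" and "0 < \<epsilon>" for v \<epsilon>
  proof -
    define r where "r n c x = v x - (\<Sum>i<n. c i * e i x)" for n :: nat and c and x :: "real^'n"
    define f where "f i = L2_inner \<Omega> v (e i)" for i
    have vL: "v \<in> L2 \<Omega>" and vH: "v \<in> H0 \<Omega> s D B"
      using v core_subset_L2 core_subset_H0[OF R] by auto
    have r_core: "r n c \<in> core" for n c
      unfolding r_def[abs_def] using v e_core by (intro core.diff_closed core.sum_closed)
    obtain n1 c1 where c1: "energy_form s D B (\<lambda>x. v x - (\<Sum>i<n1. c1 i * \<phi> i x)) (\<lambda>x. v x - (\<Sum>i<n1. c1 i * \<phi> i x)) < \<epsilon> / 2"
      using basis vH \<open>0 < \<epsilon>\<close> unfolding eigenfunction_basis_def orthogonal_basis_def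
      by (meson half_gt_zero)
    have res_H0: "(\<lambda>x. v x - (\<Sum>i<n1. c1 i * \<phi> i x)) \<in> H0 \<Omega> s D B"
      by (rule H0_residual(1)[OF R vH \<phi>])
    have "energy_form s D B (\<lambda>x. v x - (\<Sum>i<n1. c1 i * \<phi> i x)) (\<lambda>x. v x - (\<Sum>i<n1. c1 i * \<phi> i x)) = F (r n1 c1) (r n1 c1)"
      using energy_form_eq[OF R res_H0 res_H0] same[OF res[of v c1 n1] res[of v c1 n1]] v
      by (simp add: F_def H0_residual(2)[OF R vH \<phi>] r_def[abs_def] e_def)
    with c1 have 1: "F (r n1 c1) (r n1 c1) < \<epsilon> / 2"
      by simp
    \<comment> \<open>Half of \<epsilon> is reserved for \<open>F\<close> and half for \<kappa>
      times the L2 norm squared; the added 1 keeps the denominator positive when \<kappa> is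
      0.\<close>
    have "0 < \<epsilon> / (2 * (\<bar>\<kappa>\<bar> + 1))"
      using \<open>0 < \<epsilon>\<close> by simp
    then obtain n2 c2 where 2: "L2_inner \<Omega> (r n2 c2) (r n2 c2) < \<epsilon> / (2 * (\<bar>\<kappa>\<bar> + 1))"
      using L2 vL unfolding orthonormal_basis_def orthogonal_basis_def r_def[abs_def] by meson
    \<comment> \<open>Fourier sums of this length beat both approximations, the one in energy and
      the one in L2.\<close>
    define N where "N = max n1 n2"
    have "F (r N f) (r N f) \<le> F (r n1 c1) (r n1 c1)"
      unfolding r_def[abs_def]
    proof (rule F.fourier_best_approx)
      \<comment> \<open>Both sides equal \<open>lam i * f i\<close>: the eigenvalue scales the
        product and the normalization alike, so the L2 coefficients are the energy coefficients
        too.\<close>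
      show "f i * F (e i) (e i) = F v (e i)" for i
        using Fe[OF v, of i] Fe[OF e_core, of i i] one F.ip_sym[OF v e_core] L2.ip_sym[OF vL e_L2]
        by (simp add: f_def)
    qed (use v e_core Fe one orth pos N_def in auto)
    moreover have "L2_inner \<Omega> (r N f) (r N f) \<le> L2_inner \<Omega> (r n2 c2) (r n2 c2)"
      unfolding r_def[abs_def]
      by (rule L2.fourier_best_approx) (use vL e_L2 one orth N_def in \<open>auto simp: f_def\<close>)
    ultimately have "F (r N f) (r N f) < \<epsilon> / 2" and 3: "L2_inner \<Omega> (r N f) (r N f) < \<epsilon> / (2 * (\<bar>\<kappa>\<bar> + 1))"
      using 1 2 by auto
    moreover have "\<kappa> * L2_inner \<Omega> (r N f) (r N f) \<le> (\<bar>\<kappa>\<bar> + 1) * L2_inner \<Omega> (r N f) (r N f)"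
      using L2.ip_nonneg[of "r N f"] r_core core_subset_L2 by (intro mult_right_mono) auto
    moreover have "(\<bar>\<kappa>\<bar> + 1) * L2_inner \<Omega> (r N f) (r N f) < \<epsilon> / 2"
      using 3 by (simp add: field_simps)
    ultimately have "core_form (r N f) (r N f) < \<epsilon>"
      by (simp add: F_def)
    then show ?thesis
      unfolding r_def[abs_def] by blast
  qed
  have "AE x in lebesgue_on \<Omega>. 0 \<le> e 0 x"
    using basis by (auto simp: eigenfunction_basis_def e_def cutoff_def elim: eventually_mono)
  then show ?thesis
    using e L2 dense unfolding core_basis_def e_def by blast
qed

text \<open>The way back, needed only for the limit. On the whole space the shift is 0, so
  \<open>core_form\<close> of a cutoff is already the energy.\<close>

lemma eigenfunction_basis_if_core_basis:
  assumes basis: "core_basis lam e" and pos: "\<And>k. 0 < lam k"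
  shows "eigenfunction_basis \<Omega> s UNIV (\<lambda>x. UNIV) lam e"
proof -
  note R = realizes_UNIV
  have e: "e k \<in> core_eigenspace (lam k)" and L2: "orthonormal_basis (L2 \<Omega>) (L2_inner \<Omega>) e" for k
    using basis by (auto simp: core_basis_def)
  have e_core: "e k \<in> core" for k
    using e[of k] by (simp add: core_eigenspace_def)
  then have e_H0: "e k \<in> H0 \<Omega> s UNIV (\<lambda>x. UNIV)" for k
    using core_subset_H0[OF R] by blast
  have ee: "energy_form s UNIV (\<lambda>x. UNIV) (e i) (e j) = lam i * L2_inner \<Omega> (e i) (e j)" for i j
    using e[of i] e_core energy_form_eq[OF R e_H0 e_H0] by (simp add: core_eigenspace_def)
  have one: "L2_inner \<Omega> (e i) (e i) = 1" and orth: "i \<noteq> j \<Longrightarrow> L2_inner \<Omega> (e i) (e j) = 0" for i j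
    using L2 by (auto simp: orthonormal_basis_def orthogonal_basis_def)
  have "is_eigenfunction \<Omega> s UNIV (\<lambda>x. UNIV) (lam k) (e k)" for k
  proof -
    have "\<not> (AE x in lebesgue. e k x = 0)"
    proof
      assume "AE x in lebesgue. e k x = 0"
      then have "(\<integral>x. e k x * e k x \<partial>lebesgue) = 0"
        by (intro integral_eq_zero_AE) (auto elim: eventually_mono)
      then show False
        using one[of k] e_core by (simp add: L2_inner_eq_lebesgue)
    qed
    then show ?thesis
      using e[of k] core_eigenspace_subset[OF R, of "lam k"] AE_zero_iff[OF R e_H0, of k] e_core
      by (simp add: is_eigenfunction_def subset_iff)
  qed
  moreover have "orthogonal_basis (H0 \<Omega> s UNIV (\<lambda>x. UNIV)) (energy_form s UNIV (\<lambda>x. UNIV)) e"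
    unfolding orthogonal_basis_def
  proof (intro conjI allI ballI impI)
    show "energy_form s UNIV (\<lambda>x. UNIV) (e i) (e i) \<noteq> 0" for i
      using pos[of i] by (simp add: ee one)
    show "energy_form s UNIV (\<lambda>x. UNIV) (e i) (e j) = 0" if "i \<noteq> j" for i j
      using that by (simp add: ee orth)
  next
    fix v :: "real^'n \<Rightarrow> real" and \<epsilon> :: real
    assume v: "v \<in> H0 \<Omega> s UNIV (\<lambda>x. UNIV)" and "0 < \<epsilon>"
    then have "cutoff \<Omega> v \<in> core"
      by (simp add: H0_iff[OF R])
    with \<open>0 < \<epsilon>\<close> obtain n c where "core_form (\<lambda>x. cutoff \<Omega> v x - (\<Sum>i<n. c i * e i x)) (\<lambda>x. cutoff \<Omega> v x - (\<Sum>i<n. c i * e i x)) < \<epsilon>"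
      using basis unfolding core_basis_def by meson
    moreover have res_H0: "(\<lambda>x. v x - (\<Sum>i<n. c i * e i x)) \<in> H0 \<Omega> s UNIV (\<lambda>x. UNIV)"
      by (rule H0_residual(1)[OF R v e_H0])
    ultimately have "energy_form s UNIV (\<lambda>x. UNIV) (\<lambda>x. v x - (\<Sum>i<n. c i * e i x)) (\<lambda>x. v x - (\<Sum>i<n. c i * e i x)) < \<epsilon>"
      using energy_form_eq[OF R res_H0 res_H0] e_core
      by (simp add: H0_residual(2)[OF R v e_H0])
    then show "\<exists>n c. energy_form s UNIV (\<lambda>x. UNIV) (\<lambda>x. v x - (\<Sum>i<n. c i * e i x)) (\<lambda>x. v x - (\<Sum>i<n. c i * e i x)) < \<epsilon>"
      by blast
  qed (rule e_H0)
  ultimately show ?thesis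
    using basis by (simp add: eigenfunction_basis_def core_basis_def)
qed

end

subsection \<open>Subsequences of eigenfunction bases\<close>

context dirichlet_domain
begin

context
  fixes lam :: "nat \<Rightarrow> real"
  assumes mono_lam: "mono lam" and lam_at_top: "filterlim lam at_top sequentially"
begin

text \<open>Every index with eigenvalue \<open>lam k\<close> lies below this bound, so expansions
  within an eigenspace become sums over \<open>{..<n}\<close>. It depends on \<open>k\<close> only
  through \<open>lam k\<close>.\<close>

definition level_bound :: "nat \<Rightarrow> nat" where
  "level_bound k = (LEAST n. \<forall>j\<ge>n. lam k < lam j)"

lemma level_bound: "level_bound k \<le> j \<Longrightarrow> lam k < lam j"
proof -
  have "eventually (\<lambda>j. lam k < lam j) sequentially"
    using lam_at_top by (simp add: filterlim_at_top_dense)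
  then have "\<exists>n. \<forall>j\<ge>n. lam k < lam j"
    by (simp add: eventually_sequentially)
  from LeastI_ex[OF this] show "level_bound k \<le> j \<Longrightarrow> lam k < lam j"
    unfolding level_bound_def by blast
qed

lemma less_level_bound: "k < level_bound k"
  using level_bound[of k k] by (cases "k < level_bound k") auto

lemma core_basisD:
  assumes "core_basis lam e"
  shows "e k \<in> core" "e k \<in> L2 \<Omega>" "v \<in> core \<Longrightarrow> core_form (e k) v = lam k * L2_inner \<Omega> (e k) v"
    and "L2_inner \<Omega> (e i) (e j) = (if i = j then 1 else 0)"
proof -
  have "e k \<in> core_eigenspace (lam k)"
    using assms by (simp add: core_basis_def)
  then show "e k \<in> core" "v \<in> core \<Longrightarrow> core_form (e k) v = lam k * L2_inner \<Omega> (e k) v"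
    by (simp_all add: core_eigenspace_def)
  then show "e k \<in> L2 \<Omega>"
    using core_subset_L2 by blast
  show "L2_inner \<Omega> (e i) (e j) = (if i = j then 1 else 0)"
    using assms by (simp add: core_basis_def orthonormal_basis_def orthogonal_basis_def)
qed

lemma core_basis_dense_L2:
  assumes "core_basis lam e" "v \<in> L2 \<Omega>" "0 < \<epsilon>"
  shows "\<exists>n c. L2_inner \<Omega> (\<lambda>x. v x - (\<Sum>i<n. c i * e i x)) (\<lambda>x. v x - (\<Sum>i<n. c i * e i x)) < \<epsilon>"
  using assms unfolding core_basis_def orthonormal_basis_def orthogonal_basis_def by blast

text \<open>By symmetry the energy of the pair can be evaluated with either eigenvalue.\<close>

lemma core_basis_inner_eq_0:
  assumes e: "core_basis lam e" and f: "core_basis lam f" and "lam k \<noteq> lam j"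
  shows "L2_inner \<Omega> (f k) (e j) = 0"
proof -
  have "lam k * L2_inner \<Omega> (f k) (e j) = lam j * L2_inner \<Omega> (f k) (e j)"
    using core_basisD(3)[OF f core_basisD(1)[OF e], of k j] core_basisD(3)[OF e core_basisD(1)[OF f], of j k]
      core.ip_sym[OF core_basisD(1)[OF f] core_basisD(1)[OF e], of k j]
      L2.ip_sym[OF core_basisD(2)[OF f] core_basisD(2)[OF e], of k j] by auto
  then show ?thesis
    using \<open>lam k \<noteq> lam j\<close> by simp
qed

text \<open>Only finitely many coefficients of \<open>f k\<close> survive, and density in L2 forces
  the remainder of that finite expansion to have norm 0. A null vector is orthogonal to every
  \<open>w\<close>.\<close>

lemma core_basis_parseval:
  assumes e: "core_basis lam e" and f: "core_basis lam f" and n: "level_bound k \<le> n" and w: "w \<in> L2 \<Omega>"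
  shows "L2_inner \<Omega> (f k) w = (\<Sum>j<n. L2_inner \<Omega> (f k) (e j) * L2_inner \<Omega> (e j) w)"
proof -
  note eD = core_basisD[OF e] and fD = core_basisD[OF f]
  define r where "r m c x = f k x - (\<Sum>j<m. c j * e j x)" for m :: nat and c and x :: "real^'n"
  define a where "a j = L2_inner \<Omega> (f k) (e j)" for j
  have r: "r m c \<in> L2 \<Omega>" for m c
    unfolding r_def[abs_def] by (intro L2.diff_closed L2.sum_closed eD fD)
  have "L2_inner \<Omega> (r n a) (r n a) \<le> 0 + \<epsilon>" if "0 < \<epsilon>" for \<epsilon>
  proof -
    obtain m c where m: "L2_inner \<Omega> (r m c) (r m c) < \<epsilon>"
      using core_basis_dense_L2[OF e fD(2) \<open>0 < \<epsilon>\<close>, of k] unfolding r_def[abs_def] by blast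
    have "a j = 0" if "n \<le> j" for j
      using core_basis_inner_eq_0[OF e f, of k j] level_bound[of k j] n that by (auto simp: a_def)
    \<comment> \<open>Padding with zero coefficients, so that the length can exceed that of the
      approximation being compared.\<close>
    then have "(\<Sum>j<n. a j * e j x) = (\<Sum>j<max m n. a j * e j x)" for x
      by (intro sum.mono_neutral_left) auto
    then have "r n a = r (max m n) a"
      by (simp add: r_def fun_eq_iff)
    moreover have "L2_inner \<Omega> (r (max m n) a) (r (max m n) a) \<le> L2_inner \<Omega> (r m c) (r m c)"
      unfolding r_def[abs_def] by (rule L2.fourier_best_approx) (auto simp: eD fD a_def)
    ultimately show ?thesis
      using m by simp
  qed
  then have "L2_inner \<Omega> (r n a) (r n a) \<le> 0"
    by (rule field_le_epsilon)
  then have "L2_inner \<Omega> (r n a) (r n a) = 0"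
    using L2.ip_nonneg[OF r] by (rule antisym)
  then have "L2_inner \<Omega> (r n a) w = 0"
    by (rule L2.ip_null[OF r _ w])
  then show ?thesis
    using w eD fD by (simp add: r_def[abs_def] L2.ip_diff L2.ip_sum L2.sum_closed a_def)
qed

text \<open>Relative to the fixed basis \<open>e = \<psi> 0\<close> every \<open>\<psi> m\<close> is
  an infinite matrix made of finite orthogonal blocks, one per eigenvalue. Orthogonality of rows and
  of columns are finite identities and survive the entrywise limit \<open>A\<close>. Rows make the
  limit functions orthonormal; columns recover \<open>e\<close> from them, hence density.\<close>

lemma core_basis_subsequence:
  assumes \<psi>: "\<And>m :: nat. core_basis lam (\<psi> m)" and simple: "lam 0 < lam 1"
  obtains r \<phi> where "strict_mono (r :: nat \<Rightarrow> nat)" "core_basis lam \<phi>"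
    "\<And>k. (\<lambda>m. L2_inner \<Omega> (\<lambda>x. \<psi> (r m) k x - \<phi> k x) (\<lambda>x. \<psi> (r m) k x - \<phi> k x)) \<longlonglongrightarrow> 0"
proof -
  define e where "e = \<psi> 0"
  define a where "a m k j = L2_inner \<Omega> (\<psi> m k) (e j)" for m k j
  have e: "core_basis lam e"
    by (simp add: e_def \<psi>)
  note eD = core_basisD[OF e] and \<psi>D = core_basisD[OF \<psi>]
  have "norm (a m (fst p) (snd p)) \<le> 1" for m and p :: "nat \<times> nat"
    using L2.ip_le_one[OF \<psi>D(2) eD(2)] eD(4) \<psi>D(4) by (simp add: a_def)
  \<comment> \<open>Diagonal extraction over the countably many index pairs, all entries being
    bounded by 1.\<close>
  then obtain r where r: "strict_mono (r :: nat \<Rightarrow> nat)"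
    and "\<And>p. p \<in> (UNIV :: (nat \<times> nat) set) \<Longrightarrow> \<exists>l. (\<lambda>m. a (r m) (fst p) (snd p)) \<longlonglongrightarrow> l"
    using function_convergent_subsequence[of "UNIV :: (nat \<times> nat) set" "\<lambda>m p. a m (fst p) (snd p)" 1]
    by (metis (no_types) countableI_type)
  from this(2)[of "(k, j)" for k j] have "\<exists>l. (\<lambda>m. a (r m) k j) \<longlonglongrightarrow> l" for k j
    by simp
  then obtain A where A: "\<And>k j. (\<lambda>m. a (r m) k j) \<longlonglongrightarrow> A k j"
    by metis
  have A0: "A k j = 0" if "lam k \<noteq> lam j" for k j
    using LIMSEQ_unique[OF A[of k j]] core_basis_inner_eq_0[OF e \<psi> that] by (simp add: a_def)
  \<comment> \<open>Parseval for two members of \<open>\<psi> m\<close>; the length of the sum does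
    not depend on \<open>m\<close>, so the limit may be taken termwise.\<close>
  have A_rows: "(\<Sum>j<n. A k j * A l j) = (if k = l then 1 else 0)" if n: "level_bound k \<le> n" for k l n
  proof (rule LIMSEQ_unique)
    show "(\<lambda>m. \<Sum>j<n. a (r m) k j * a (r m) l j) \<longlonglongrightarrow> (\<Sum>j<n. A k j * A l j)"
      by (intro tendsto_intros A)
    have "(\<Sum>j<n. a m k j * a m l j) = (if k = l then 1 else 0)" for m
      using core_basis_parseval[OF e \<psi> n \<psi>D(2), of m m l] L2.ip_sym[OF eD(2) \<psi>D(2)]
      by (simp add: a_def \<psi>D(4))
    then show "(\<lambda>m. \<Sum>j<n. a (r m) k j * a (r m) l j) \<longlonglongrightarrow> (if k = l then 1 else 0)"
      by simp
  qed
  \<comment> \<open>The same with the roles of \<open>e\<close> and \<open>\<psi> m\<close>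
    exchanged.\<close>
  have A_cols: "(\<Sum>k<n. A k i * A k j) = (if i = j then 1 else 0)" if n: "level_bound i \<le> n" for i j n
  proof (rule LIMSEQ_unique)
    show "(\<lambda>m. \<Sum>k<n. a (r m) k i * a (r m) k j) \<longlonglongrightarrow> (\<Sum>k<n. A k i * A k j)"
      by (intro tendsto_intros A)
    have "(\<Sum>k<n. a m k i * a m k j) = (if i = j then 1 else 0)" for m
      using core_basis_parseval[OF \<psi> e n eD(2), of j m] L2.ip_sym[OF eD(2) \<psi>D(2)]
      by (simp add: a_def eD(4))
    then show "(\<lambda>m. \<Sum>k<n. a (r m) k i * a (r m) k j) \<longlonglongrightarrow> (if i = j then 1 else 0)"
      by simp
  qed
  define \<phi> where "\<phi> k x = (\<Sum>j<level_bound k. A k j * e j x)" for k x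
  have \<phi>_core: "\<phi> k \<in> core" for k
    unfolding \<phi>_def[abs_def] by (intro core.sum_closed eD)
  then have \<phi>_L2: "\<phi> k \<in> L2 \<Omega>" for k
    using core_subset_L2 by blast
  have \<phi>_inner: "L2_inner \<Omega> (\<phi> k) w = (\<Sum>j<level_bound k. A k j * L2_inner \<Omega> (e j) w)" if "w \<in> L2 \<Omega>" for k w
    unfolding \<phi>_def[abs_def] by (intro L2.ip_sum eD that)
  have \<phi>_e: "L2_inner \<Omega> (\<phi> k) (e j) = A k j" for k j
  proof -
    have "L2_inner \<Omega> (\<phi> k) (e j) = (\<Sum>i<level_bound k. if i = j then A k j else 0)"
      unfolding \<phi>_inner[OF eD(2)] by (intro sum.cong) (auto simp: eD(4))
    then show ?thesis
      using A0[of k j] level_bound[of k j] by (auto simp: not_less)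
  qed
  have \<phi>_eigen: "\<phi> k \<in> core_eigenspace (lam k)" for k
    unfolding core_eigenspace_def
  proof (intro CollectI conjI ballI \<phi>_core)
    fix v assume v: "v \<in> core"
    then have vL: "v \<in> L2 \<Omega>"
      using core_subset_L2 by blast
    have "core_form (\<phi> k) v = (\<Sum>j<level_bound k. A k j * core_form (e j) v)"
      unfolding \<phi>_def[abs_def] by (intro core.ip_sum eD v)
    also have "\<dots> = (\<Sum>j<level_bound k. lam k * (A k j * L2_inner \<Omega> (e j) v))"
      using A0 by (intro sum.cong) (auto simp: eD(3)[OF v])
    finally show "core_form (\<phi> k) v = lam k * L2_inner \<Omega> (\<phi> k) v"
      by (simp add: \<phi>_inner[OF vL] sum_distrib_left)
  qed
  have \<phi>_orth: "L2_inner \<Omega> (\<phi> k) (\<phi> l) = (if k = l then 1 else 0)" for k l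
    using A_rows[OF order.refl, of k l] \<phi>_e L2.ip_sym[OF eD(2) \<phi>_L2] by (simp add: \<phi>_inner[OF \<phi>_L2])
  have e_expand: "e i x = (\<Sum>k<n. A k i * \<phi> k x)" if n: "level_bound i \<le> n" for i n x
  proof -
    have "A k i * \<phi> k x = (\<Sum>j<level_bound i. A k i * A k j * e j x)" for k
    proof (cases "lam k = lam i")
      \<comment> \<open>Within one eigenvalue the level bounds coincide, so the sum defining
        \<open>\<phi> k\<close> already has the range wanted for \<open>i\<close>; otherwise the
        coefficient vanishes.\<close>
      case True
      then have "level_bound k = level_bound i"
        by (simp add: level_bound_def)
      then show ?thesis
        by (simp add: \<phi>_def sum_distrib_left mult.assoc)
    qed (simp add: A0)
    then have "(\<Sum>k<n. A k i * \<phi> k x) = (\<Sum>j<level_bound i. \<Sum>k<n. A k i * A k j * e j x)"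
      by (simp add: sum.swap[of _ "{..<n}"])
    also have "\<dots> = (\<Sum>j<level_bound i. if i = j then e i x else 0)"
      by (intro sum.cong refl) (simp add: A_cols[OF n] flip: sum_distrib_right)
    finally show ?thesis
      using less_level_bound[of i] by simp
  qed
  have span: "\<exists>N d. \<forall>x. (\<Sum>i<n. c i * e i x) = (\<Sum>k<N. d k * \<phi> k x)" for n :: nat and c :: "nat \<Rightarrow> real"
  proof (intro exI allI)
    fix x
    \<comment> \<open>A common length that is at least each single level bound.\<close>
    let ?N = "\<Sum>i<n. level_bound i"
    have "c i * e i x = (\<Sum>k<?N. c i * A k i * \<phi> k x)" if "i < n" for i
      using e_expand[of i ?N x] member_le_sum[of i "{..<n}" level_bound] that
      by (simp add: sum_distrib_left mult.assoc)
    then have "(\<Sum>i<n. c i * e i x) = (\<Sum>i<n. \<Sum>k<?N. c i * A k i * \<phi> k x)"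
      by simp
    then show "(\<Sum>i<n. c i * e i x) = (\<Sum>k<?N. (\<Sum>i<n. c i * A k i) * \<phi> k x)"
      by (simp add: sum.swap[of _ "{..<n}"] sum_distrib_right)
  qed
  \<comment> \<open>Kept general in \<open>ip\<close>: equality of the finite spans transfers
    density in L2 and in energy alike.\<close>
  have dense: "\<exists>n c. ip (\<lambda>x. v x - (\<Sum>i<n. c i * \<phi> i x)) (\<lambda>x. v x - (\<Sum>i<n. c i * \<phi> i x)) < \<epsilon>"
    if approx: "\<exists>n c. ip (\<lambda>x. v x - (\<Sum>i<n. c i * e i x)) (\<lambda>x. v x - (\<Sum>i<n. c i * e i x)) < \<epsilon>"
    for ip :: "(real^'n \<Rightarrow> real) \<Rightarrow> (real^'n \<Rightarrow> real) \<Rightarrow> real" and v \<epsilon>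
  proof -
    obtain n c where nc: "ip (\<lambda>x. v x - (\<Sum>i<n. c i * e i x)) (\<lambda>x. v x - (\<Sum>i<n. c i * e i x)) < \<epsilon>"
      using approx by blast
    obtain N d where "\<And>x. (\<Sum>i<n. c i * e i x) = (\<Sum>k<N. d k * \<phi> k x)"
      using span by blast
    then show ?thesis
      using nc by (intro exI[of _ N] exI[of _ d]) simp
  qed
  have \<phi>_basis: "core_basis lam \<phi>"
    unfolding core_basis_def orthonormal_basis_def orthogonal_basis_def
  proof (intro conjI allI impI ballI)
    show "\<exists>n c. L2_inner \<Omega> (\<lambda>x. v x - (\<Sum>i<n. c i * \<phi> i x)) (\<lambda>x. v x - (\<Sum>i<n. c i * \<phi> i x)) < \<epsilon>"
      if "v \<in> L2 \<Omega>" "0 < \<epsilon>" for v \<epsilon>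
      using core_basis_dense_L2[OF e that] by (rule dense)
    show "\<exists>n c. core_form (\<lambda>x. v x - (\<Sum>i<n. c i * \<phi> i x)) (\<lambda>x. v x - (\<Sum>i<n. c i * \<phi> i x)) < \<epsilon>"
      if "v \<in> core" "0 < \<epsilon>" for v \<epsilon>
      using e that unfolding core_basis_def by (intro dense) blast
    \<comment> \<open>The sign condition passes to the limit: products of nonnegative first
      eigenfunctions have nonnegative integral, and simplicity of the first eigenvalue leaves
      \<open>\<phi> 0\<close> a multiple of \<open>e 0\<close> by the limit coefficient.\<close>
    have "0 \<le> a m 0 0" for m
    proof -
      have "AE x in lebesgue_on \<Omega>. 0 \<le> \<psi> m 0 x" "AE x in lebesgue_on \<Omega>. 0 \<le> e 0 x"
        using e \<psi> by (simp_all add: core_basis_def)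
      then have "AE x in lebesgue_on \<Omega>. 0 \<le> \<psi> m 0 x * e 0 x"
        by eventually_elim simp
      then show ?thesis
        unfolding a_def L2_inner_def by (rule integral_nonneg_AE)
    qed
    then have "0 \<le> A 0 0"
      by (intro LIMSEQ_le_const[OF A[of 0 0]]) auto
    moreover have "\<phi> 0 x = A 0 0 * e 0 x" for x
    proof -
      have "A 0 j = 0" if "j \<noteq> 0" for j
        using A0[of 0 j] monoD[OF mono_lam, of 1 j] simple that by auto
      then have "\<phi> 0 x = (\<Sum>j\<in>{0}. A 0 j * e j x)"
        unfolding \<phi>_def using less_level_bound[of 0] by (intro sum.mono_neutral_right) auto
      then show ?thesis
        by simp
    qed
    ultimately show "AE x in lebesgue_on \<Omega>. 0 \<le> \<phi> 0 x"
      using e by (auto simp: core_basis_def elim: eventually_mono)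
  qed (simp_all add: \<phi>_eigen \<phi>_L2 \<phi>_orth)
  have "(\<lambda>m. L2_inner \<Omega> (\<lambda>x. \<psi> (r m) k x - \<phi> k x) (\<lambda>x. \<psi> (r m) k x - \<phi> k x)) \<longlonglongrightarrow> 0" for k
  proof -
    \<comment> \<open>Two unit vectors: the squared distance is 2 minus twice their inner product,
      and that inner product tends to the squared norm of row \<open>k\<close> of \<open>A\<close>,
      which is 1.\<close>
    have "L2_inner \<Omega> (\<lambda>x. \<psi> m k x - \<phi> k x) (\<lambda>x. \<psi> m k x - \<phi> k x)
        = 2 - 2 * (\<Sum>j<level_bound k. A k j * a m k j)" for m
      using L2.ip_diff_self[OF \<psi>D(2) \<phi>_L2, of m k k] L2.ip_sym[OF \<psi>D(2) \<phi>_L2, of m k k]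
        L2.ip_sym[OF eD(2) \<psi>D(2), of _ m k]
      by (simp add: \<phi>_inner[OF \<psi>D(2)] a_def \<psi>D(4) \<phi>_orth)
    moreover have "(\<lambda>m. 2 - 2 * (\<Sum>j<level_bound k. A k j * a (r m) k j))
        \<longlonglongrightarrow> 2 - 2 * (\<Sum>j<level_bound k. A k j * A k j)"
      by (intro tendsto_intros A)
    ultimately show ?thesis
      using A_rows[of k "level_bound k" k] by simp
  qed
  then show ?thesis
    by (rule that[OF r \<phi>_basis])
qed

end

end

theorem theorem5:
  fixes \<Omega> :: "(real^'n) set" and s :: real
    and lam :: "real \<Rightarrow> nat \<Rightarrow> real" and phi :: "real \<Rightarrow> nat \<Rightarrow> real^'n \<Rightarrow> real"
    and lam_inf :: "nat \<Rightarrow> real"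
  assumes "0 < s" and "s < 1" and "2 * s < real CARD('n)"
    and "open \<Omega>" and "connected \<Omega>" and "\<Omega> \<noteq> {}" and "bounded \<Omega>" and "lipschitz_boundary \<Omega>"
    and "\<And>\<delta>. 0 < \<delta> \<Longrightarrow> eigenvalue_listing \<Omega> s (enlarged \<Omega> \<delta>) (\<lambda>x. ball x \<delta>) (lam \<delta>)"
    and "\<And>\<delta>. 0 < \<delta> \<Longrightarrow>
      eigenfunction_basis \<Omega> s (enlarged \<Omega> \<delta>) (\<lambda>x. ball x \<delta>) (lam \<delta>) (phi \<delta>)"
    and "eigenvalue_listing \<Omega> s UNIV (\<lambda>x. UNIV) lam_inf"
  shows "(\<forall>k. ((\<lambda>\<delta>. lam \<delta> k) \<longlongrightarrow> lam_inf k) at_top) \<and>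
    (\<forall>d. filterlim d at_top sequentially \<longrightarrow>
      (\<exists>r phi_inf. strict_mono (r :: nat \<Rightarrow> nat) \<and>
        eigenfunction_basis \<Omega> s UNIV (\<lambda>x. UNIV) lam_inf phi_inf \<and>
        (\<forall>k. (\<lambda>j. \<integral>x. (phi (d (r j)) k x - phi_inf k x)\<^sup>2 \<partial>lebesgue_on \<Omega>) \<longlonglongrightarrow> 0))) \<and>
    (\<forall>k. ((\<lambda>\<delta>. real (eigen_multiplicity \<Omega> s (enlarged \<Omega> \<delta>) (\<lambda>x. ball x \<delta>) (lam \<delta> k)))
          \<longlongrightarrow> real (eigen_multiplicity \<Omega> s UNIV (\<lambda>x. UNIV) (lam_inf k))) at_top)"
proof -
  interpret dirichlet_domain \<Omega> s
    using assms(1,2,4) by unfold_locales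
  note listing = assms(9) and basis = assms(10) and listing_inf = assms(11)
  obtain b where "0 < b" and b: "\<And>x. x \<in> \<Omega> \<Longrightarrow> norm x \<le> b"
    using \<open>bounded \<Omega>\<close> by (auto simp: bounded_pos)
  define \<kappa> where "\<kappa> \<delta> = frac_const CARD('n) s * enn2real (tail_mass (far \<delta> :: (real^'n) set) s)" for \<delta>
  \<comment> \<open>Points of the domain have norm at most \<open>b\<close>, so beyond
    \<open>2 * b\<close> the horizon exceeds all their mutual distances.\<close>
  have R: "realizes (enlarged \<Omega> \<delta>) (\<lambda>x. ball x \<delta>) (\<kappa> \<delta>)" if "2 * b < \<delta>" for \<delta>
    unfolding \<kappa>_def
  proof (rule realizes_enlarged)
    show "norm (x - y) < \<delta>" if "x \<in> \<Omega>" "y \<in> \<Omega>" for x y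
      using b[OF that(1)] b[OF that(2)] norm_triangle_ineq4[of x y] \<open>2 * b < \<delta>\<close> by simp
  qed (use that \<open>0 < b\<close> in simp)
  have shift: "lam \<delta> k + \<kappa> \<delta> = lam_inf k" if "2 * b < \<delta>" for \<delta> k
    using eigenvalue_listings_eq[OF R[OF that] listing realizes_UNIV listing_inf] that \<open>0 < b\<close> by simp
  have large: "\<forall>\<^sub>F \<delta> in at_top. 2 * b < \<delta>"
    by (rule eventually_gt_at_top)
  have "((\<lambda>\<delta>. lam \<delta> k) \<longlongrightarrow> lam_inf k) at_top" for k
  proof -
    have "(\<kappa> \<longlongrightarrow> frac_const CARD('n) s * 0) at_top"
      unfolding \<kappa>_def[abs_def] by (intro tendsto_mult_left tail_mass_finite_tendsto_0 s_pos)
    then have "((\<lambda>\<delta>. lam_inf k - \<kappa> \<delta>) \<longlongrightarrow> lam_inf k - frac_const CARD('n) s * 0) at_top"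
      by (intro tendsto_diff tendsto_const)
    moreover have "\<forall>\<^sub>F \<delta> in at_top. lam_inf k - \<kappa> \<delta> = lam \<delta> k"
      using large by eventually_elim (simp flip: shift)
    ultimately show ?thesis
      by (simp add: tendsto_cong)
  qed
  moreover have "((\<lambda>\<delta>. real (eigen_multiplicity \<Omega> s (enlarged \<Omega> \<delta>) (\<lambda>x. ball x \<delta>) (lam \<delta> k)))
      \<longlongrightarrow> real (eigen_multiplicity \<Omega> s UNIV (\<lambda>x. UNIV) (lam_inf k))) at_top" for k
  proof (rule tendsto_eventually, use large in eventually_elim)
    fix \<delta> :: real assume \<delta>: "2 * b < \<delta>"
    show "real (eigen_multiplicity \<Omega> s (enlarged \<Omega> \<delta>) (\<lambda>x. ball x \<delta>) (lam \<delta> k))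
        = real (eigen_multiplicity \<Omega> s UNIV (\<lambda>x. UNIV) (lam_inf k))"
      \<comment> \<open>Both multiplicities are the dimension of
        \<open>core_eigenspace (lam_inf k)\<close>, so the convergence is eventual equality.\<close>
      by (simp add: eigen_multiplicity_eq[OF R[OF \<delta>]] eigen_multiplicity_eq[OF realizes_UNIV] shift[OF \<delta>])
  qed
  moreover have "\<exists>r phi_inf. strict_mono (r :: nat \<Rightarrow> nat) \<and>
        eigenfunction_basis \<Omega> s UNIV (\<lambda>x. UNIV) lam_inf phi_inf \<and>
        (\<forall>k. (\<lambda>j. \<integral>x. (phi (d (r j)) k x - phi_inf k x)\<^sup>2 \<partial>lebesgue_on \<Omega>) \<longlonglongrightarrow> 0)"
    if d: "filterlim d at_top sequentially" for d :: "nat \<Rightarrow> real"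
  proof -
    have pos: "0 < lam' k" if "eigenvalue_listing \<Omega> s D B lam'" for D B lam' and k :: nat
      using that monoD[of lam' 0 k] by (auto simp: eigenvalue_listing_def)
    \<comment> \<open>The horizons \<open>d m\<close> are large only from some index on. The
      extraction runs on that tail, and the offset returns in the final subsequence
      \<open>r m + m0\<close>.\<close>
    obtain m0 where m0: "\<And>m. m0 \<le> m \<Longrightarrow> 2 * b < d m"
      using d by (auto simp: filterlim_at_top_dense eventually_sequentially)
    define \<psi> where "\<psi> m k = cutoff \<Omega> (phi (d (m + m0)) k)" for m k
    have "core_basis lam_inf (\<psi> m)" for m
    proof -
      have \<delta>: "2 * b < d (m + m0)" "0 < d (m + m0)"
        using m0[of "m + m0"] \<open>0 < b\<close> by auto
      show ?thesis
        using core_basis_cutoff[OF R[OF \<delta>(1)] basis[OF \<delta>(2)] pos[OF listing[OF \<delta>(2)]]]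
        by (simp add: shift[OF \<delta>(1)] \<psi>_def[abs_def])
    qed
    then obtain r \<phi> where r: "strict_mono (r :: nat \<Rightarrow> nat)" and \<phi>: "core_basis lam_inf \<phi>"
      and lim: "\<And>k. (\<lambda>m. L2_inner \<Omega> (\<lambda>x. \<psi> (r m) k x - \<phi> k x) (\<lambda>x. \<psi> (r m) k x - \<phi> k x)) \<longlonglongrightarrow> 0"
      using core_basis_subsequence[of lam_inf \<psi>] listing_inf by (auto simp: eigenvalue_listing_def)
    have "(\<integral>x. (phi (d (r m + m0)) k x - \<phi> k x)\<^sup>2 \<partial>lebesgue_on \<Omega>)
        = L2_inner \<Omega> (\<lambda>x. \<psi> (r m) k x - \<phi> k x) (\<lambda>x. \<psi> (r m) k x - \<phi> k x)" for m k
      unfolding L2_inner_def by (intro Bochner_Integration.integral_cong)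
        (auto simp: \<psi>_def cutoff_def power2_eq_square)
    moreover have "strict_mono (\<lambda>m. r m + m0)"
      using r by (simp add: strict_mono_def)
    moreover have "eigenfunction_basis \<Omega> s UNIV (\<lambda>x. UNIV) lam_inf \<phi>"
      using \<phi> pos[OF listing_inf] by (rule eigenfunction_basis_if_core_basis)
    ultimately show ?thesis
      using lim by (intro exI[of _ "\<lambda>m. r m + m0"] exI[of _ \<phi>]) simp
  qed
  ultimately show ?thesis
    by blast
qed

end
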